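(* Let $d\ge 1$ be an integer, let $Q=[0,1)^d\subset\mathbb{R}^d$ be the unit cube, and let $T$ be a subset of $\mathbb{R}^d$. Then $T$ is a spectrum for $Q$ if and only if $T$ is a tiling set for $Q$.
   Context: For $t,x\in\mathbb{R}^d$ write $tx=t_1x_1+\cdots+t_dx_d$ and $e_t(x):=e^{i2\pi tx}$. The space $L^2(Q)$ (complex-valued functions) has inner product $\langle f,g\rangle:=\int_Q f\,\overline{g}\,dm$, where $m$ is Lebesgue measure. A set $T\subset\mathbb{R}^d$ is a spectrum for $Q$ if the exponentials $e_t$, $t\in T$, form an orthonormal basis (complete orthonormal system) for $L^2(Q)$. A set $T\subset\mathbb{R}^d$ is a tiling set for $Q$ if each $x\in\mathbb{R}^d$ can be written uniquely as $x=q+t$ with $q\in Q$ and $t\in T$. *)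

theory Defs
  imports "HOL-Analysis.Analysis"
begin

text \<open>Elements of \<open>L\<^sup>2(Q)\<close> are represented by functions on the whole space; only their
  restriction to \<open>Q\<close> matters, and functions that agree almost everywhere on \<open>Q\<close> are at
  \<open>L2_norm\<close>-distance 0 instead of being identified.\<close>

definition L2 :: "'a::euclidean_space set \<Rightarrow> ('a \<Rightarrow> complex) set" where
  "L2 Q = {f. f \<in> borel_measurable (lebesgue_on Q) \<and>
              integrable (lebesgue_on Q) (\<lambda>x. (cmod (f x))\<^sup>2)}"

definition L2_inner ::
    "'a::euclidean_space set \<Rightarrow> ('a \<Rightarrow> complex) \<Rightarrow> ('a \<Rightarrow> complex) \<Rightarrow> complex" where
  "L2_inner Q f g = (LINT x|lebesgue_on Q. f x * cnj (g x))"

definition L2_norm :: "'a::euclidean_space set \<Rightarrow> ('a \<Rightarrow> complex) \<Rightarrow> real" where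
  "L2_norm Q f = sqrt (Re (L2_inner Q f f))"

definition exponential :: "'a::euclidean_space \<Rightarrow> 'a \<Rightarrow> complex" where
  "exponential t x = exp (\<i> * of_real (2 * pi * (t \<bullet> x)))"

text \<open>An orthonormal basis is an orthonormal family in \<open>L\<^sup>2(Q)\<close> whose finite linear combinations
  are dense in \<open>L\<^sup>2(Q)\<close>. The family is indexed by \<open>I\<close>, so orthonormality also forces distinct
  indices to give distinct elements.\<close>

definition L2_orthonormal_basis ::
    "'a::euclidean_space set \<Rightarrow> 'i set \<Rightarrow> ('i \<Rightarrow> 'a \<Rightarrow> complex) \<Rightarrow> bool" where
  "L2_orthonormal_basis Q I e \<longleftrightarrow>
     (\<forall>i\<in>I. e i \<in> L2 Q) \<and>
     (\<forall>i\<in>I. \<forall>j\<in>I. L2_inner Q (e i) (e j) = (if i = j then 1 else 0)) \<and>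
     (\<forall>f\<in>L2 Q. \<forall>\<epsilon>>0. \<exists>F c. finite F \<and> F \<subseteq> I \<and>
        L2_norm Q (\<lambda>x. f x - (\<Sum>i\<in>F. c i * e i x)) < \<epsilon>)"

definition is_spectrum :: "'a::euclidean_space set \<Rightarrow> 'a set \<Rightarrow> bool" where
  "is_spectrum Q T \<longleftrightarrow> L2_orthonormal_basis Q T exponential"

definition is_tiling_set :: "'a::euclidean_space set \<Rightarrow> 'a set \<Rightarrow> bool" where
  "is_tiling_set Q T \<longleftrightarrow> (\<forall>x. \<exists>!p. p \<in> Q \<times> T \<and> x = fst p + snd p)"

definition unit_cube :: "(real ^ 'n) set" where
  "unit_cube = {x. \<forall>i. 0 \<le> x $ i \<and> x $ i < 1}"

end

theory Submission
  imports Defs "HOL-Probability.Sinc_Integral"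
begin

text \<open>Let \<open>g\<close> be the squared modulus of the Fourier transform of the unit cube, a product of
  squares of cardinal sines (called \<open>kern\<close> below). It has integral 1, and \<open>g (s - t)\<close> is
  the squared modulus of the inner product of the exponentials with frequencies \<open>s\<close> and
  \<open>t\<close>. It vanishes exactly if some coordinate of \<open>s - t\<close> is a nonzero integer. So an
  orthogonal set of exponentials has frequencies \<open>T\<close> for which the cubes \<open>t + Q\<close> are
  disjoint, and Bessel's inequality says that the sum \<open>G x\<close> of \<open>g (x - t)\<close> over
  \<open>T\<close> is at most 1, with equality exactly if the exponential with frequency \<open>x\<close> lies in
  the closed span (\<open>approximable_iff_kern_sum\<close>). A spectrum is thus a set whose translates of
  \<open>g\<close> tile space, in the sense that they add up to 1.

  The translates of \<open>g\<close> and those of the cube are compared as follows. Let \<open>F x\<close> be the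
  number of cubes covering \<open>x\<close>. By Tonelli's theorem, the average of \<open>G (x - y)\<close> over
  \<open>y\<close> in the cube equals the average of \<open>F (x - y)\<close> over \<open>y\<close> with weight
  \<open>g\<close> (\<open>convolution_identity\<close>). Both functions are at most 1 and both weights have
  total mass 1, so if one of the two functions is constantly 1, the other is 1 wherever its weight
  sees it.

  From spectrum to tiling: \<open>G\<close> is constantly 1, and a hole of the packing by half-open cubes
  would contain a box, which would make the average of \<open>F\<close> too small
  (\<open>kern_sum_full_imp_tiling\<close>).

  From tiling to spectrum: orthogonality is Keller's theorem (\<open>Keller\<close>), proved by sliding
  classes of tiles along coordinate axes. Then \<open>G = 1\<close> almost everywhere, so almost every
  exponential lies in the closed span of those with frequencies in \<open>T\<close>, hence by continuity
  every exponential does (\<open>tiling_imp_approximable_exponential\<close>). By the theorem of Stone and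
  Weierstrass all continuous functions do, and finally all square integrable ones
  (\<open>approximable_all\<close>).\<close>

section \<open>Tilings by translates of the unit cube\<close>

definition in_tile :: "real ^ 'n \<Rightarrow> real ^ 'n \<Rightarrow> bool" where
  "in_tile t x \<longleftrightarrow> (\<forall>i. t $ i \<le> x $ i \<and> x $ i < t $ i + 1)"

lemma in_tile_iff_diff: "in_tile t x \<longleftrightarrow> x - t \<in> unit_cube"
  unfolding in_tile_def unit_cube_def by (auto simp: algebra_simps)

lemma is_tiling_set_unit_cube_iff:
  "is_tiling_set unit_cube T \<longleftrightarrow> (\<forall>x. \<exists>!t. t \<in> T \<and> in_tile t x)"
proof -
  have "(\<exists>!p. p \<in> unit_cube \<times> T \<and> x = fst p + snd p) \<longleftrightarrow> (\<exists>!t. t \<in> T \<and> in_tile t x)" for x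
  proof
    assume "\<exists>!p. p \<in> unit_cube \<times> T \<and> x = fst p + snd p"
    then obtain p where p: "p \<in> unit_cube \<times> T \<and> x = fst p + snd p"
      and p': "\<forall>p'. p' \<in> unit_cube \<times> T \<and> x = fst p' + snd p' \<longrightarrow> p' = p"
      by (rule ex1E) (rule that)
    obtain q t where pq: "p = (q, t)" by fastforce
    have qt: "q \<in> unit_cube" "t \<in> T" "x = q + t" using p by (auto simp: pq)
    note u = p'[rule_format, unfolded pq]
    show "\<exists>!t. t \<in> T \<and> in_tile t x"
    proof (rule ex1I[of _ t])
      show "t \<in> T \<and> in_tile t x" using qt by (simp add: in_tile_iff_diff)
      show "s = t" if "s \<in> T \<and> in_tile s x" for s
        using u[of "(x - s, s)"] that by (simp add: in_tile_iff_diff)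
    qed
  next
    assume "\<exists>!t. t \<in> T \<and> in_tile t x"
    then obtain t where t: "t \<in> T" "in_tile t x" and u: "\<And>s. s \<in> T \<and> in_tile s x \<Longrightarrow> s = t"
      by (auto elim!: ex1E)
    show "\<exists>!p. p \<in> unit_cube \<times> T \<and> x = fst p + snd p"
    proof (rule ex1I[of _ "(x - t, t)"])
      show "(x - t, t) \<in> unit_cube \<times> T \<and> x = fst (x - t, t) + snd (x - t, t)"
        using t by (simp add: in_tile_iff_diff)
      show "p = (x - t, t)" if p: "p \<in> unit_cube \<times> T \<and> x = fst p + snd p" for p
      proof -
        have "snd p = t" using u[of "snd p"] p by (auto simp: in_tile_iff_diff)
        with p show ?thesis by (cases p) auto
      qed
    qed
  qed
  then show ?thesis unfolding is_tiling_set_def by simp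
qed

lemma tiling_obtain:
  assumes "is_tiling_set unit_cube T"
  obtains t where "t \<in> T" "in_tile t x"
  using assms unfolding is_tiling_set_unit_cube_iff by blast

lemma tiling_unique:
  assumes "is_tiling_set unit_cube T" "s \<in> T" "t \<in> T" "in_tile s x" "in_tile t x"
  shows "s = t"
  using assms unfolding is_tiling_set_unit_cube_iff by blast

text \<open>Cubes whose corners differ by less than 1 in every coordinate meet, at the coordinatewise
  maximum of the two corners.\<close>

lemma in_tile_overlap:
  assumes "\<And>i. \<bar>s $ i - t $ i\<bar> < 1"
  shows "in_tile s (\<chi> i. max (s $ i) (t $ i))" "in_tile t (\<chi> i. max (s $ i) (t $ i))"
proof -
  have "\<bar>s $ i - t $ i\<bar> < 1" for i by (rule assms)
  then have "s $ i < t $ i + 1" "t $ i < s $ i + 1" for i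
    by (simp_all add: abs_less_iff algebra_simps)
  then show "in_tile s (\<chi> i. max (s $ i) (t $ i))" "in_tile t (\<chi> i. max (s $ i) (t $ i))"
    by (auto simp: in_tile_def)
qed

section \<open>Keller's theorem\<close>

text \<open>A line in direction \<open>k\<close> is cut by a tiling into consecutive half-open unit intervals. If the
  interval of \<open>t\<close> ends at \<open>t $ k + 1\<close>, then the tile covering that end point cannot start
  earlier without meeting \<open>t\<close>, so it starts exactly there.\<close>

lemma tiling_step:
  fixes T :: "(real ^ 'n) set"
  assumes T: "is_tiling_set unit_cube T"
    and t: "t \<in> T" "in_tile t x" and s: "s \<in> T" "in_tile s (x + axis k 1)"
  shows "s $ k = t $ k + 1"
proof -
  \<comment> \<open>the end point of the interval cut out by \<open>t\<close> on the line\<close>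
  define y where "y = (\<chi> i. if i = k then t $ k + 1 else x $ i)"
  obtain s' where s': "s' \<in> T" "in_tile s' y"
    using tiling_obtain[OF T] by blast
  have le: "s' $ k \<le> t $ k + 1" "t $ k < s' $ k"
    using s'(2) unfolding in_tile_def y_def by (auto dest: spec[of _ k])
  have eq: "s' $ k = t $ k + 1"
  proof (rule ccontr)
    assume "s' $ k \<noteq> t $ k + 1"
    with le have lt: "s' $ k < t $ k + 1" by simp
    \<comment> \<open>a common point of the two tiles if \<open>s'\<close> starts too early\<close>
    define z where "z = (\<chi> i. if i = k then s' $ k else x $ i)"
    have "s' $ i \<le> z $ i \<and> z $ i < s' $ i + 1" for i
      using s'(2) by (cases "i = k") (auto simp: in_tile_def y_def z_def dest: spec[of _ i])
    moreover have "t $ i \<le> z $ i \<and> z $ i < t $ i + 1" for i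
      using t(2) le lt by (cases "i = k") (auto simp: in_tile_def z_def)
    ultimately have "in_tile s' z" "in_tile t z" by (simp_all add: in_tile_def)
    then have "s' = t" using tiling_unique[OF T s'(1) t(1)] by blast
    with le show False by simp
  qed
  have "in_tile s' (x + axis k 1)"
    unfolding in_tile_def
  proof (intro allI)
    fix i
    show "s' $ i \<le> (x + axis k 1) $ i \<and> (x + axis k 1) $ i < s' $ i + 1"
      using s'(2) t(2) eq unfolding in_tile_def y_def
      by (cases "i = k") (auto simp: axis_def dest!: spec[of _ i])
  qed
  then show ?thesis using tiling_unique[OF T s'(1) s(1)] s(2) eq by blast
qed

text \<open>Both directions come from the single step: going backwards, the forward step applied to the
  earlier tile lands on the tile already known, by uniqueness.\<close>

lemma tiling_int_steps:
  fixes T :: "(real ^ 'n) set" and m :: int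
  assumes T: "is_tiling_set unit_cube T"
    and t: "t \<in> T" "in_tile t x" and s: "s \<in> T" "in_tile s (x + of_int m *\<^sub>R axis k 1)"
  shows "s $ k = t $ k + of_int m"
  using s
proof (induction m arbitrary: s rule: int_induct[where k=0])
  case base
  then show ?case using tiling_unique[OF T _ t(1) _ t(2)] by auto
next
  case (step1 m)
  obtain u where u: "u \<in> T" "in_tile u (x + of_int m *\<^sub>R axis k 1)"
    using tiling_obtain[OF T] by blast
  have "s $ k = u $ k + 1"
    by (rule tiling_step[OF T u step1.prems(1)]) (use step1.prems in \<open>simp add: algebra_simps\<close>)
  with step1.IH[OF u] show ?case by simp
next
  case (step2 m)
  obtain u where u: "u \<in> T" "in_tile u (x + of_int m *\<^sub>R axis k 1)"
    using tiling_obtain[OF T] by blast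
  have "u $ k = s $ k + 1"
    by (rule tiling_step[OF T step2.prems u(1)]) (use u in \<open>simp add: algebra_simps\<close>)
  with step2.IH[OF u] show ?case by simp
qed

text \<open>All tiles that meet one line in direction \<open>k\<close> lie in one class modulo 1 of the
  \<open>k\<close>-th coordinate: the tile reached from \<open>t\<close> by a suitable integer number of
  steps already covers the given point.\<close>

lemma tiling_line_congruent:
  fixes T :: "(real ^ 'n) set"
  assumes T: "is_tiling_set unit_cube T"
    and t: "t \<in> T" "in_tile t x" and s: "s \<in> T" "in_tile s (x + r *\<^sub>R axis k 1)"
  shows "s $ k - t $ k \<in> \<int>"
proof -
  define m where "m = \<lfloor>x $ k + r - t $ k\<rfloor>"
  obtain u where u: "u \<in> T" "in_tile u (x + of_int m *\<^sub>R axis k 1)"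
    using tiling_obtain[OF T] by blast
  have uk: "u $ k = t $ k + of_int m" by (rule tiling_int_steps[OF T t u])
  have "in_tile u (x + r *\<^sub>R axis k 1)"
    unfolding in_tile_def
  proof (intro allI)
    fix i
    show "u $ i \<le> (x + r *\<^sub>R axis k 1) $ i \<and> (x + r *\<^sub>R axis k 1) $ i < u $ i + 1"
    proof (cases "i = k")
      case True
      have "of_int m \<le> x $ k + r - t $ k" "x $ k + r - t $ k < of_int m + 1"
        unfolding m_def by linarith+
      then show ?thesis using True uk by (simp add: axis_def)
    next
      case False
      then show ?thesis using u(2) unfolding in_tile_def
        by (auto simp: axis_def dest!: spec[of _ i])
    qed
  qed
  then have "s = u" using tiling_unique[OF T s(1) u(1) s(2)] by blast
  then show ?thesis using uk by simp
qed

text \<open>A line in direction \<open>k\<close> meets only tiles of a single class modulo 1, so the region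
  covered by the tiles of one class is a union of such lines. Translation along \<open>k\<close>
  maps this region to itself, and sliding the whole class by any amount \<open>b\<close> gives a tiling
  again.\<close>

lemma tiling_shift_class:
  fixes T :: "(real ^ 'n) set" and a b :: real and k :: "'n"
  assumes T: "is_tiling_set unit_cube T"
  defines "A \<equiv> {t \<in> T. t $ k - a \<in> \<int>}"
  shows "is_tiling_set unit_cube ((T - A) \<union> (\<lambda>t. t + b *\<^sub>R axis k 1) ` A)"
proof -
  have tr: "in_tile (s + b *\<^sub>R axis k 1) x \<longleftrightarrow> in_tile s (x + (- b) *\<^sub>R axis k 1)" for s x :: "real ^ 'n"
    unfolding in_tile_iff_diff by (simp add: algebra_simps)
  have cong: "s \<in> A \<longleftrightarrow> t \<in> A"
    if "t \<in> T" "in_tile t x" "s \<in> T" "in_tile s (x + r *\<^sub>R axis k 1)" for s t x r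
  proof -
    have st: "s $ k - t $ k \<in> \<int>" by (rule tiling_line_congruent[OF T that])
    have "s $ k - a \<in> \<int> \<longleftrightarrow> t $ k - a \<in> \<int>"
      using Ints_diff[OF _ st, of "s $ k - a"] Ints_add[OF _ st, of "t $ k - a"] by auto
    then show ?thesis using that by (auto simp: A_def)
  qed
  show ?thesis
    unfolding is_tiling_set_unit_cube_iff
  proof
    fix x
    obtain t where t: "t \<in> T" "in_tile t x" using tiling_obtain[OF T] by blast
    obtain s where s: "s \<in> T" "in_tile s (x + (- b) *\<^sub>R axis k 1)" using tiling_obtain[OF T] by blast
    have u1: "u = t" if "u \<in> T" "in_tile u x" for u
      using tiling_unique[OF T that(1) t(1) that(2) t(2)] .
    have u2: "u = s" if "u \<in> T" "in_tile u (x + (- b) *\<^sub>R axis k 1)" for u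
      using tiling_unique[OF T that(1) s(1) that(2) s(2)] .
    have AT: "A \<subseteq> T" by (auto simp: A_def)
    have st: "s \<in> A \<longleftrightarrow> t \<in> A" by (rule cong[OF t s])
    show "\<exists>!u. u \<in> (T - A) \<union> (\<lambda>t. t + b *\<^sub>R axis k 1) ` A \<and> in_tile u x"
    proof (cases "t \<in> A")
      case False
      show ?thesis
      proof (rule ex1I[of _ t])
        show "t \<in> (T - A) \<union> (\<lambda>t. t + b *\<^sub>R axis k 1) ` A \<and> in_tile t x" using t False by auto
        show "u = t" if "u \<in> (T - A) \<union> (\<lambda>t. t + b *\<^sub>R axis k 1) ` A \<and> in_tile u x" for u
          using that u1 u2 st False AT tr by auto
      qed
    next
      case True
      show ?thesis
      proof (rule ex1I[of _ "s + b *\<^sub>R axis k 1"])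
        show "s + b *\<^sub>R axis k 1 \<in> (T - A) \<union> (\<lambda>t. t + b *\<^sub>R axis k 1) ` A \<and>
            in_tile (s + b *\<^sub>R axis k 1) x"
          using s st True tr by auto
        show "u = s + b *\<^sub>R axis k 1"
          if "u \<in> (T - A) \<union> (\<lambda>t. t + b *\<^sub>R axis k 1) ` A \<and> in_tile u x" for u
          using that u1 u2 st True AT tr by auto
      qed
    qed
  qed
qed

text \<open>This is both the conclusion of Keller's theorem and the condition for the exponentials with
  frequencies \<open>s\<close> and \<open>t\<close> to be orthogonal on the unit cube.\<close>

definition int_separated :: "real ^ 'n \<Rightarrow> real ^ 'n \<Rightarrow> bool" where
  "int_separated s t \<longleftrightarrow> (\<exists>i. s $ i - t $ i \<in> \<int> \<and> s $ i \<noteq> t $ i)"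

text \<open>Suppose two distinct tiles \<open>s\<close>, \<open>t\<close> have no coordinate in which they differ by a
  nonzero integer. Take a coordinate where they differ by at least 1; the difference is not an
  integer, so the class of \<open>s\<close> can be slid until the difference is 1/2, and \<open>t\<close> does
  not move. This preserves the tiling and the hypothesis and leaves the other coordinates alone.
  In the end all differences are below 1, and the two tiles overlap.\<close>

theorem Keller:
  fixes T :: "(real ^ 'n) set"
  assumes "is_tiling_set unit_cube T" "s \<in> T" "t \<in> T" "s \<noteq> t"
  shows "int_separated s t"
proof (rule ccontr)
  assume "\<not> int_separated s t"
  with assms show False
  proof (induction "card {i. 1 \<le> \<bar>s $ i - t $ i\<bar>}" arbitrary: T s rule: less_induct)
    case less
    note T = less.prems(1)
    have ns: "s $ i = t $ i" if "s $ i - t $ i \<in> \<int>" for i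
      using less.prems(5) that unfolding int_separated_def by blast
    show False
    proof (cases "\<exists>k. 1 \<le> \<bar>s $ k - t $ k\<bar>")
      case False
      then have "\<And>i. \<bar>s $ i - t $ i\<bar> < 1" by (meson not_le)
      from in_tile_overlap[OF this] show False
        using tiling_unique[OF T less.prems(2,3)] less.prems(4) by blast
    next
      case True
      then obtain k where k: "1 \<le> \<bar>s $ k - t $ k\<bar>" by blast
      define A where "A = {u \<in> T. u $ k - s $ k \<in> \<int>}"
      \<comment> \<open>the shift that brings the difference in coordinate \<open>k\<close> to 1/2\<close>
      define b where "b = t $ k + 1/2 - s $ k"
      define T' where "T' = (T - A) \<union> (\<lambda>u. u + b *\<^sub>R axis k 1) ` A"
      define s' where "s' = s + b *\<^sub>R axis k 1"
      have nk: "s $ k - t $ k \<notin> \<int>" using ns[of k] k by auto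
      have T': "is_tiling_set unit_cube T'"
        unfolding T'_def A_def by (rule tiling_shift_class[OF T])
      have "s \<in> A" using less.prems by (simp add: A_def)
      then have s'T: "s' \<in> T'" by (auto simp: T'_def s'_def)
      have "t $ k - s $ k \<notin> \<int>" using nk Ints_minus[of "t $ k - s $ k"] by auto
      then have tT: "t \<in> T'" using less.prems by (simp add: T'_def A_def)
      have s'k: "s' $ k = t $ k + 1/2" by (simp add: s'_def b_def axis_def)
      have s'i: "s' $ i = s $ i" if "i \<noteq> k" for i using that by (simp add: s'_def axis_def)
      have ne: "s' \<noteq> t" using s'k by auto
      have half: "(1/2::real) \<notin> \<int>"
      proof
        assume "(1/2::real) \<in> \<int>"
        then obtain n :: int where "1/2 = (of_int n :: real)" by (auto elim: Ints_cases)
        then have "2 * n = 1" by linarith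
        then show False by presburger
      qed
      have sep: "\<not> int_separated s' t"
        unfolding int_separated_def
      proof clarify
        fix i assume "s' $ i - t $ i \<in> \<int>" "s' $ i \<noteq> t $ i"
        then show False using ns[of i] s'i[of i] s'k half by (cases "i = k") auto
      qed
      have "{i. 1 \<le> \<bar>s' $ i - t $ i\<bar>} = {i. 1 \<le> \<bar>s $ i - t $ i\<bar>} - {k}"
      proof (intro set_eqI)
        fix i
        show "i \<in> {i. 1 \<le> \<bar>s' $ i - t $ i\<bar>} \<longleftrightarrow> i \<in> {i. 1 \<le> \<bar>s $ i - t $ i\<bar>} - {k}"
          using s'k s'i[of i] by (cases "i = k") auto
      qed
      then have "card {i. 1 \<le> \<bar>s' $ i - t $ i\<bar>} < card {i. 1 \<le> \<bar>s $ i - t $ i\<bar>}"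
        using k by (simp add: card_Diff1_less del: card_Diff_insert)
      from less.hyps[OF this T' s'T tT ne sep] show False by blast
    qed
  qed
qed

section \<open>The square of the cardinal sine\<close>

definition fejer :: "real \<Rightarrow> real" where
  "fejer u = (sinc (pi * u))\<^sup>2"

lemma fejer_nonneg: "0 \<le> fejer u"
  by (simp add: fejer_def)

lemma isCont_fejer: "isCont fejer u"
  unfolding fejer_def by (intro continuous_intros isCont_o2[OF _ isCont_sinc])

lemma borel_measurable_fejer [measurable]: "fejer \<in> borel_measurable borel"
  by (intro borel_measurable_continuous_onI continuous_at_imp_continuous_on ballI isCont_fejer)

lemma fejer_eq_0_iff: "fejer u = 0 \<longleftrightarrow> u \<in> \<int> \<and> u \<noteq> 0"
proof -
  have "sin (pi * u) = 0 \<longleftrightarrow> u \<in> \<int>"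
    by (auto simp: sin_zero_iff_int2 Ints_def mult.commute)
  then show ?thesis by (auto simp: fejer_def)
qed

lemma fejer_0 [simp]: "fejer 0 = 1"
  by (simp add: fejer_def)

text \<open>Integration by parts: apart from the boundary term \<open>sin x * sinc x\<close>, the integral of the
  square of \<open>sinc\<close> is that of \<open>sin (2 * x) / x\<close>. The point 0 needs its own argument
  because the quotient formula for \<open>sinc\<close> is not valid there.\<close>

lemma DERIV_sinc_square_antideriv:
  "((\<lambda>x. Si (2 * x) - sin x * sinc x) has_real_derivative (sinc x)\<^sup>2) (at x)"
proof (cases "x = 0")
  case True
  have "((\<lambda>x. sin x * sinc x) has_real_derivative 1) (at 0)"
    unfolding CARAT_DERIV
    \<comment> \<open>\<open>sin z * sinc z = (sinc z)^2 * z\<close> for all \<open>z\<close>, which is the difference quotient form\<close>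
    by (rule exI[of _ "\<lambda>z. (sinc z)\<^sup>2"])
       (auto simp: power2_eq_square intro!: continuous_intros isCont_sinc)
  moreover have "((\<lambda>x. Si (2 * x)) has_real_derivative 2) (at 0)"
    using DERIV_chain2[OF DERIV_Si, of "\<lambda>x. 2 * x" 2 0 UNIV]
    by (auto intro!: derivative_eq_intros)
  ultimately show ?thesis using DERIV_diff[of _ 2 0 UNIV _ 1] True by fastforce
next
  case False
  have "sin (x * 2) = 2 * sin x * cos x" using sin_double[of x] by (simp add: mult.commute)
  then have "((\<lambda>x. Si (2 * x) - sin x * (sin x / x)) has_real_derivative (sinc x)\<^sup>2) (at x)"
    using False
    by (auto intro!: derivative_eq_intros DERIV_chain2[OF DERIV_Si]
        simp: power2_eq_square field_simps)
  then show ?thesis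
    by (rule has_field_derivative_transform_within_open[of _ _ _ "- {0}"])
       (use False in auto)
qed

lemma nn_integral_sinc_square_half:
  "(\<integral>\<^sup>+x. ennreal ((sinc x)\<^sup>2) * indicator {0..} x \<partial>lborel) = ennreal (pi / 2)"
proof -
  have "filterlim (\<lambda>x::real. 2 * x) at_top at_top"
    by (simp add: filterlim_tendsto_pos_mult_at_top[OF tendsto_const _ filterlim_ident])
  then have 1: "((\<lambda>x. Si (2 * x)) \<longlongrightarrow> pi / 2) at_top"
    by (rule filterlim_compose[OF Si_at_top])
  have 2: "((\<lambda>x. sin x * sinc x) \<longlongrightarrow> 0) at_top"
  proof (rule tendsto_rabs_zero_cancel, rule tendsto_sandwich[of "\<lambda>_. 0" _ _ "\<lambda>x. 1 / x"])
    show "\<forall>\<^sub>F x in at_top. \<bar>sin x * sinc x\<bar> \<le> 1 / x"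
      using eventually_gt_at_top[of "0::real"]
    proof eventually_elim
      case (elim x)
      have "\<bar>sin x\<bar> * \<bar>sin x\<bar> \<le> 1 * 1" by (intro mult_mono) auto
      with elim show ?case by (simp add: abs_mult divide_right_mono)
    qed
    show "((\<lambda>x::real. 1 / x) \<longlongrightarrow> 0) at_top"
      by (rule tendsto_divide_0[OF tendsto_const filterlim_at_top_imp_at_infinity[OF filterlim_ident]])
  qed auto
  have "((\<lambda>x. Si (2 * x) - sin x * sinc x) \<longlongrightarrow> pi / 2) at_top"
    using tendsto_diff[OF 1 2] by simp
  from nn_integral_FTC_atLeast[OF _ DERIV_sinc_square_antideriv _ this, of 0]
  show ?thesis by (simp add: Si_def zero_ereal_def)
qed

lemma nn_integral_fejer: "(\<integral>\<^sup>+u. ennreal (fejer u) \<partial>lborel) = 1"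
proof -
  let ?f = "\<lambda>x. ennreal ((sinc x)\<^sup>2)"
  have "(\<integral>\<^sup>+x. ?f x \<partial>lborel) =
      (\<integral>\<^sup>+x. ?f x * indicator {0..} x + ?f x * indicator {..<0} x \<partial>lborel)"
    by (intro nn_integral_cong) (auto split: split_indicator)
  also have "\<dots> = (\<integral>\<^sup>+x. ?f x * indicator {0..} x \<partial>lborel) + (\<integral>\<^sup>+x. ?f x * indicator {..<0} x \<partial>lborel)"
    by (intro nn_integral_add) auto
  also have "(\<integral>\<^sup>+x. ?f x * indicator {..<0} x \<partial>lborel) = (\<integral>\<^sup>+x. ?f x * indicator {0<..} x \<partial>lborel)"
    by (subst nn_integral_real_affine[of _ "-1" 0])
       (auto intro!: nn_integral_cong split: split_indicator)
  also have "\<dots> = (\<integral>\<^sup>+x. ?f x * indicator {0..} x \<partial>lborel)"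
    by (intro nn_integral_cong_AE AE_I[of _ _ "{0}"]) (auto split: split_indicator)
  also have "(\<integral>\<^sup>+x. ?f x * indicator {0..} x \<partial>lborel) = ennreal (pi / 2)"
    by (rule nn_integral_sinc_square_half)
  also have "ennreal (pi / 2) + ennreal (pi / 2) = ennreal pi"
    by (subst ennreal_plus[symmetric]) auto
  finally have "(\<integral>\<^sup>+x. ?f x \<partial>lborel) = ennreal pi" .
  moreover have "(\<integral>\<^sup>+x. ?f x \<partial>lborel) = ennreal \<bar>pi\<bar> * (\<integral>\<^sup>+u. ?f (0 + pi * u) \<partial>lborel)"
    by (rule nn_integral_real_affine) auto
  moreover have "(\<lambda>u. ?f (0 + pi * u)) = (\<lambda>u. ennreal (fejer u))"
    by (simp only: fejer_def add_0)
  ultimately have "ennreal pi * (\<integral>\<^sup>+u. ennreal (fejer u) \<partial>lborel) = ennreal pi * 1" by simp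
  then show ?thesis
    by (subst (asm) ennreal_mult_cancel_left) auto
qed

section \<open>The Fourier transform of the unit cube\<close>

text \<open>The Fourier transform of the unit interval, up to the sign of the frequency.\<close>

definition interval_char :: "real \<Rightarrow> complex" where
  "interval_char u = (LINT x|lborel. indicator {0..<1} x *\<^sub>R exp (\<i> * of_real (2 * pi * (u * x))))"

text \<open>The fundamental theorem of calculus is stated for closed intervals; the end point 1 has
  measure zero.\<close>

lemma integral_indicator_half_open:
  fixes f :: "real \<Rightarrow> complex"
  assumes "continuous_on UNIV f"
  shows "integrable lborel (\<lambda>x. indicator {0..<1} x *\<^sub>R f x)"
    "(LINT x|lborel. indicator {0..<1} x *\<^sub>R f x) = (LINT x|lborel. indicator {0..1} x *\<^sub>R f x)"
proof -
  have [measurable]: "f \<in> borel_measurable borel"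
    by (rule borel_measurable_continuous_onI[OF assms])
  have ae: "AE x in lborel. indicator {0..<1::real} x *\<^sub>R f x = indicator {0..1} x *\<^sub>R f x"
    by (rule AE_I[of _ _ "{1}"]) (auto split: split_indicator)
  show "(LINT x|lborel. indicator {0..<1} x *\<^sub>R f x) = (LINT x|lborel. indicator {0..1} x *\<^sub>R f x)"
    by (rule integral_cong_AE[OF _ _ ae]) auto
  have "integrable lborel (\<lambda>x. indicator {0..1} x *\<^sub>R f x)"
    by (rule borel_integrable_compact) (use assms continuous_on_subset in auto)
  then show "integrable lborel (\<lambda>x. indicator {0..<1} x *\<^sub>R f x)"
    by (subst integrable_cong_AE[OF _ _ ae]) auto
qed

lemma cmod_exp_i_minus_1: "(cmod (exp (\<i> * of_real (2 * a)) - 1))\<^sup>2 = 4 * (sin a)\<^sup>2"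
proof -
  have "(cmod (exp (\<i> * of_real (2 * a)) - 1))\<^sup>2 = (cos (2 * a) - 1)\<^sup>2 + (sin (2 * a))\<^sup>2"
    by (simp add: cmod_power2 Re_exp Im_exp)
  also have "\<dots> = (2 * (sin a)\<^sup>2)\<^sup>2 + 4 * (sin a)\<^sup>2 * (cos a)\<^sup>2"
    by (simp add: cos_double_sin sin_double power_mult_distrib)
  also have "\<dots> = 4 * (sin a)\<^sup>2"
    unfolding cos_squared_eq by (simp add: power2_eq_square algebra_simps)
  finally show ?thesis .
qed

lemma interval_char_0 [simp]: "interval_char 0 = 1"
  using integral_indicator_half_open(2)[of "\<lambda>_. 1"] by (simp add: interval_char_def)

lemma cmod_interval_char: "(cmod (interval_char u))\<^sup>2 = fejer u"
proof (cases "u = 0")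
  case False
  define c where "c = \<i> * of_real (2 * pi * u)"
  have c0: "c \<noteq> 0" using False by (simp add: c_def)
  have e: "exp (\<i> * of_real (2 * pi * (u * x))) = exp (c * of_real x)" for x
    by (simp add: c_def mult_ac)
  have "interval_char u = (LINT x|lborel. indicator {0..1} x *\<^sub>R exp (c * of_real x))"
    unfolding interval_char_def e
    by (rule integral_indicator_half_open(2)) (intro continuous_intros)
  also have "\<dots> = exp (c * of_real 1) / c - exp (c * of_real 0) / c"
    by (rule integral_FTC_Icc)
       (auto intro!: continuous_intros derivative_eq_intros has_vector_derivative_real_field simp: c0)
  finally have "interval_char u = (exp (\<i> * of_real (2 * (pi * u))) - 1) / c"
    by (simp add: diff_divide_distrib c_def mult_ac)
  then have "(cmod (interval_char u))\<^sup>2 = 4 * (sin (pi * u))\<^sup>2 / (cmod c)\<^sup>2"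
    by (simp add: norm_divide power_divide cmod_exp_i_minus_1 del: of_real_mult)
  also have "(cmod c)\<^sup>2 = 4 * (pi * u)\<^sup>2"
    by (simp add: c_def norm_mult power_mult_distrib)
  finally show ?thesis using False by (simp add: fejer_def power_divide)
qed simp

lemma Basis_vec_real: "(Basis :: (real ^ 'n) set) = (\<lambda>i. axis i 1) ` UNIV"
  by (auto simp: Basis_vec_def)

lemma prod_Basis_vec:
  fixes x :: "real ^ 'n"
  shows "(\<Prod>b\<in>Basis. f (x \<bullet> b) b) = (\<Prod>i\<in>UNIV. f (x $ i) (axis i 1))"
  unfolding Basis_vec_real
  by (subst prod.reindex) (auto simp: inj_on_def axis_eq_axis inner_axis)

lemma prod_over_Basis_vec:
  shows "(\<Prod>b\<in>(Basis :: (real ^ 'n) set). f b) = (\<Prod>i\<in>UNIV. f (axis i 1))"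
  unfolding Basis_vec_real
  by (subst prod.reindex) (auto simp: inj_on_def axis_eq_axis)

lemma integral_lborel_prod:
  fixes f :: "'a::euclidean_space \<Rightarrow> real \<Rightarrow> complex"
  assumes int: "\<And>b. b \<in> Basis \<Longrightarrow> integrable lborel (f b)"
  shows "(LINT x|lborel. (\<Prod>b\<in>Basis. f b (x \<bullet> b))) = (\<Prod>b\<in>Basis. (LINT x|lborel. f b x))"
proof -
  interpret product_sigma_finite "\<lambda>_::'a. lborel :: real measure" ..
  have [measurable]: "f b \<in> borel_measurable borel" if "b \<in> Basis" for b
    using borel_measurable_integrable[OF int[OF that]] by simp
  have "(LINT x|lborel. (\<Prod>b\<in>Basis. f b (x \<bullet> b))) =
      (LINT x|(\<Pi>\<^sub>M b\<in>(Basis::'a set). (lborel :: real measure)).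
        (\<Prod>b\<in>Basis. f b ((\<Sum>b\<in>Basis. x b *\<^sub>R b) \<bullet> b)))"
    by (subst lborel_eq, subst integral_distr) auto
  also have "\<dots> = (LINT x|(\<Pi>\<^sub>M b\<in>(Basis::'a set). (lborel :: real measure)). (\<Prod>b\<in>Basis. f b (x b)))"
    by (intro Bochner_Integration.integral_cong prod.cong) auto
  also have "\<dots> = (\<Prod>b\<in>Basis. (LINT x|lborel. f b x))"
    by (rule product_integral_prod) (use int in auto)
  finally show ?thesis .
qed

text \<open>The squared modulus of the Fourier transform of the unit cube (see \<open>cmod_cube_char\<close> below),
  that is, the Fejer kernel of several real variables.\<close>

definition kern :: "real ^ 'n \<Rightarrow> real" where
  "kern u = (\<Prod>i\<in>UNIV. fejer (u $ i))"

lemma kern_nonneg: "0 \<le> kern u"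
  by (simp add: kern_def prod_nonneg fejer_nonneg)

lemma kern_0 [simp]: "kern 0 = 1"
  by (simp add: kern_def)

lemma isCont_kern: "isCont kern u"
  unfolding kern_def by (intro continuous_intros isCont_o2[OF _ isCont_fejer])

lemma borel_measurable_kern [measurable]: "kern \<in> borel_measurable borel"
  by (intro borel_measurable_continuous_onI continuous_at_imp_continuous_on ballI isCont_kern)

text \<open>A factor vanishes exactly at the nonzero integers.\<close>

lemma kern_eq_0_iff: "kern (s - t) = 0 \<longleftrightarrow> int_separated s t"
  by (auto simp: kern_def fejer_eq_0_iff int_separated_def)

lemma nn_integral_kern: "(\<integral>\<^sup>+u. ennreal (kern (u :: real ^ 'n)) \<partial>lborel) = 1"
proof -
  have "(\<integral>\<^sup>+u. ennreal (kern (u :: real ^ 'n)) \<partial>lborel) =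
      (\<integral>\<^sup>+u. (\<Prod>b\<in>Basis. ennreal (fejer ((u :: real ^ 'n) \<bullet> b))) \<partial>lborel)"
    by (simp add: kern_def prod_ennreal fejer_nonneg prod_Basis_vec[of "\<lambda>x b. fejer x"])
  also have "\<dots> = 1"
    by (subst nn_integral_lborel_prod) (auto simp: nn_integral_fejer)
  finally show ?thesis .
qed

lemma continuous_exponential: "continuous_on S (exponential t)"
  unfolding exponential_def by (intro continuous_intros)

lemma borel_measurable_exponential [measurable]: "exponential t \<in> borel_measurable borel"
  by (intro borel_measurable_continuous_onI continuous_exponential)

lemma borel_measurable_vec_nth [measurable]: "(\<lambda>x :: real ^ 'n. x $ i) \<in> borel_measurable borel"
  by (intro borel_measurable_continuous_onI continuous_intros)

lemma unit_cube_borel [measurable]: "(unit_cube :: (real ^ 'n) set) \<in> sets borel"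
proof -
  have "unit_cube = {x :: real ^ 'n \<in> space borel. \<forall>i. 0 \<le> x $ i \<and> x $ i < 1}"
    by (auto simp: unit_cube_def)
  also have "\<dots> \<in> sets borel" by measurable
  finally show ?thesis .
qed

lemma unit_cube_lebesgue [simp]: "unit_cube \<in> sets lebesgue"
  using unit_cube_borel by (simp add: sets_completionI_sets)

lemma integral_unit_cube:
  fixes f :: "real ^ 'n \<Rightarrow> complex"
  assumes [measurable]: "f \<in> borel_measurable borel"
  shows "(LINT x|lebesgue_on unit_cube. f x) = (LINT x|lborel. indicator unit_cube x *\<^sub>R f x)"
  by (subst integral_restrict_space) (auto intro!: integral_completion)

definition cube_char :: "real ^ 'n \<Rightarrow> complex" where
  "cube_char u = (LINT x|lebesgue_on unit_cube. exponential u x)"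

lemma exponential_mult_cnj: "exponential s x * cnj (exponential t x) = exponential (s - t) x"
  by (simp add: exponential_def exp_cnj mult_exp_exp algebra_simps inner_diff_left)

lemma L2_inner_exponential: "L2_inner unit_cube (exponential s) (exponential t) = cube_char (s - t)"
  by (simp add: L2_inner_def cube_char_def exponential_mult_cnj)

lemma indicator_unit_cube:
  "(indicator unit_cube x :: 'a :: comm_semiring_1) = (\<Prod>i\<in>UNIV. indicator {0..<1} (x $ i))"
proof (cases "x \<in> unit_cube")
  case True
  then show ?thesis by (simp add: unit_cube_def)
next
  case False
  then obtain i where "indicator {0..<1} (x $ i) = (0 :: 'a)"
    by (auto simp: unit_cube_def indicator_def)
  then have "(\<Prod>i\<in>UNIV. indicator {0..<1} (x $ i)) = (0 :: 'a)" by (intro prod_zero) auto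
  then show ?thesis using False by simp
qed

lemma emeasure_unit_cube: "emeasure lborel (unit_cube :: (real ^ 'n) set) = 1"
proof -
  have "emeasure lborel (unit_cube :: (real ^ 'n) set) =
      (\<integral>\<^sup>+x. indicator (unit_cube :: (real ^ 'n) set) x \<partial>lborel)"
    by simp
  also have "\<dots> = (\<integral>\<^sup>+x. (\<Prod>b\<in>Basis. indicator {0..<1} ((x :: real ^ 'n) \<bullet> b)) \<partial>lborel)"
    by (simp only: indicator_unit_cube prod_Basis_vec[of "\<lambda>x b. indicator {0..<1} x"])
  also have "\<dots> = 1"
    by (subst nn_integral_lborel_prod) auto
  finally show ?thesis .
qed

lemma cube_char_eq_prod: "cube_char u = (\<Prod>i\<in>UNIV. interval_char (u $ i))"
proof -
  let ?f = "\<lambda>b x. indicator {0..<1} x *\<^sub>R exp (\<i> * of_real (2 * pi * ((u \<bullet> b) * x)))"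
  have "indicator unit_cube x *\<^sub>R exponential u x = (\<Prod>b\<in>Basis. ?f b (x \<bullet> b))" for x
  proof -
    have 2: "exponential u x = (\<Prod>i\<in>UNIV. exp (\<i> * of_real (2 * pi * (u $ i * x $ i))))"
      by (simp add: exponential_def inner_vec_def exp_sum[symmetric] sum_distrib_left)
    show ?thesis
      by (simp add: indicator_unit_cube 2 prod_Basis_vec scaleR_conv_of_real prod.distrib inner_axis prod_over_Basis_vec)
  qed
  then have "cube_char u = (LINT x|lborel. (\<Prod>b\<in>Basis. ?f b (x \<bullet> b)))"
    unfolding cube_char_def by (subst integral_unit_cube) auto
  also have "\<dots> = (\<Prod>b\<in>Basis. (LINT x|lborel. ?f b x))"
    by (rule integral_lborel_prod) (intro integral_indicator_half_open continuous_intros)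
  also have "\<dots> = (\<Prod>i\<in>UNIV. interval_char (u $ i))"
    by (simp add: prod_over_Basis_vec interval_char_def inner_axis)
  finally show ?thesis .
qed

lemma cmod_cube_char: "(cmod (cube_char u))\<^sup>2 = kern u"
  by (simp add: cube_char_eq_prod kern_def prod_norm[symmetric] prod_power_distrib cmod_interval_char)

lemma cube_char_0 [simp]: "cube_char 0 = 1"
  by (simp add: cube_char_eq_prod)

lemma cube_char_eq_0_iff: "cube_char (s - t) = 0 \<longleftrightarrow> int_separated s t"
  by (simp flip: kern_eq_0_iff cmod_cube_char)

section \<open>Packings by translates of the unit cube\<close>

definition packing :: "(real ^ 'n) set \<Rightarrow> bool" where
  "packing T \<longleftrightarrow> (\<forall>s\<in>T. \<forall>t\<in>T. \<forall>x. in_tile s x \<longrightarrow> in_tile t x \<longrightarrow> s = t)"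

lemma packingD: "packing T \<Longrightarrow> s \<in> T \<Longrightarrow> t \<in> T \<Longrightarrow> in_tile s x \<Longrightarrow> in_tile t x \<Longrightarrow> s = t"
  unfolding packing_def by simp

lemma tiling_imp_packing: "is_tiling_set unit_cube T \<Longrightarrow> packing T"
  unfolding packing_def using tiling_unique by metis

lemma int_separated_imp_packing:
  assumes "\<And>s t. s \<in> T \<Longrightarrow> t \<in> T \<Longrightarrow> s \<noteq> t \<Longrightarrow> int_separated s t"
  shows "packing T"
  unfolding packing_def
proof (intro ballI allI impI, rule ccontr)
  fix s t x
  assume st: "s \<in> T" "t \<in> T" and x: "in_tile s x" "in_tile t x" and "s \<noteq> t"
  from assms[OF st \<open>s \<noteq> t\<close>] obtain i where i: "s $ i - t $ i \<in> \<int>" "s $ i \<noteq> t $ i"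
    by (auto simp: int_separated_def)
  then have "1 \<le> \<bar>s $ i - t $ i\<bar>" by (intro Ints_nonzero_abs_ge1) auto
  moreover have "s $ i \<le> x $ i" "x $ i < s $ i + 1" "t $ i \<le> x $ i" "x $ i < t $ i + 1"
    using x by (auto simp: in_tile_def)
  ultimately show False by linarith
qed

text \<open>Every half-open unit cube contains exactly one integer point, obtained by rounding up its
  corner; disjoint cubes have different integer points.\<close>

lemma packing_inj_ceiling:
  fixes T :: "(real ^ 'n) set"
  assumes "packing T"
  shows "inj_on (\<lambda>t i. \<lceil>t $ i\<rceil>) T"
proof (rule inj_onI)
  fix s t assume st: "s \<in> T" "t \<in> T" and eq: "(\<lambda>i. \<lceil>s $ i\<rceil>) = (\<lambda>i. \<lceil>t $ i\<rceil>)"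
  define p :: "real ^ 'n" where "p = (\<chi> i. of_int \<lceil>s $ i\<rceil>)"
  have eq': "\<lceil>s $ i\<rceil> = \<lceil>t $ i\<rceil>" for i using fun_cong[OF eq] .
  have "in_tile s p" unfolding in_tile_def p_def
    by (auto simp: le_of_int_ceiling) (metis ceiling_correct diff_less_eq)
  moreover have "in_tile t p" unfolding in_tile_def p_def eq'
    by (auto simp: le_of_int_ceiling) (metis ceiling_correct diff_less_eq)
  ultimately show "s = t" using packingD[OF assms st] by blast
qed

lemma packing_countable:
  fixes T :: "(real ^ 'n) set"
  assumes "packing T"
  shows "countable T"
  using countable_image_inj_eq[OF packing_inj_ceiling[OF assms]] by simp

lemma packing_locally_finite:
  fixes T :: "(real ^ 'n) set"
  assumes "packing T"
  shows "finite {t \<in> T. \<forall>i. a \<le> t $ i - x $ i \<and> t $ i - x $ i \<le> b}" (is "finite ?C")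
proof -
  let ?f = "\<lambda>t i. \<lceil>t $ i\<rceil>"
  have "?f ` ?C \<subseteq> Pi\<^sub>E UNIV (\<lambda>i. {\<lceil>x $ i + a\<rceil>..\<lceil>x $ i + b\<rceil>})"
    by (auto intro!: ceiling_mono simp: algebra_simps)
  moreover have "finite (Pi\<^sub>E (UNIV :: 'n set) (\<lambda>i. {\<lceil>x $ i + a\<rceil>..\<lceil>x $ i + b\<rceil>}))"
    by (intro finite_PiE) auto
  ultimately have "finite (?f ` ?C)" by (rule finite_subset)
  moreover have "inj_on ?f ?C"
    by (rule inj_on_subset[OF packing_inj_ceiling[OF assms]]) auto
  ultimately show ?thesis by (rule finite_imageD)
qed

text \<open>Only finitely many tiles come near \<open>x\<close>. A tile that misses \<open>x\<close> either ends at or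
  before \<open>x\<close> in some coordinate, and then misses every \<open>x + z\<close> with \<open>z\<close>
  nonnegative, or starts strictly after \<open>x\<close> in some coordinate, and then misses
  \<open>x + z\<close> for small \<open>z\<close>. So a hole of a packing by half-open cubes has positive
  measure.\<close>

lemma packing_uncovered_box:
  fixes T :: "(real ^ 'n) set"
  assumes T: "packing T" and x: "\<And>t. t \<in> T \<Longrightarrow> \<not> in_tile t x"
  obtains \<delta> :: real where "0 < \<delta>" "\<delta> \<le> 1"
    "\<And>t z. t \<in> T \<Longrightarrow> (\<And>i. 0 \<le> z $ i \<and> z $ i < \<delta>) \<Longrightarrow> \<not> in_tile t (x + z)"
proof -
  let ?C = "{t \<in> T. \<forall>i. - 1 \<le> t $ i - x $ i \<and> t $ i - x $ i \<le> 1}"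
  let ?P = "\<lambda>t \<delta>. \<forall>z. (\<forall>i. 0 \<le> z $ i \<and> z $ i < \<delta>) \<longrightarrow> \<not> in_tile t (x + z)"
  have "\<forall>\<^sub>F \<delta> in at_right 0. ?P t \<delta>" if "t \<in> ?C" for t
  proof -
    from x[of t] that obtain i where i: "x $ i < t $ i \<or> t $ i + 1 \<le> x $ i"
      unfolding in_tile_def by (auto simp: not_le not_less)
    show ?thesis
    proof (cases "x $ i < t $ i")
      case True
      then have "\<forall>\<^sub>F \<delta> in at_right 0. \<delta> < t $ i - x $ i"
        by (intro eventually_at_right_less[THEN eventually_mono] order_tendstoD(2)[OF tendsto_ident_at]) auto
      then show ?thesis
        by eventually_elim (force simp: in_tile_def not_le dest: spec[of _ i])
    next
      case False
      with i have "?P t \<delta>" for \<delta> by (force simp: in_tile_def not_less dest: spec[of _ i])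
      then show ?thesis by (rule always_eventually[OF allI])
    qed
  qed
  then have "\<forall>\<^sub>F \<delta> in at_right 0. \<forall>t\<in>?C. ?P t \<delta>"
    by (intro eventually_ball_finite packing_locally_finite[OF T]) blast
  moreover have "\<forall>\<^sub>F \<delta> in at_right 0. 0 < \<delta> \<and> \<delta> < (1::real)"
    by (auto simp: eventually_at_right_field intro: exI[of _ 1])
  ultimately have "\<forall>\<^sub>F \<delta> in at_right 0. (\<forall>t\<in>?C. ?P t \<delta>) \<and> 0 < \<delta> \<and> \<delta> < (1::real)"
    by (rule eventually_conj)
  then obtain \<delta> where \<delta>: "\<forall>t\<in>?C. ?P t \<delta>" "0 < \<delta>" "\<delta> < 1"
    using eventually_happens'[OF trivial_limit_at_right_real] by blast
  show ?thesis
  proof (rule that[of \<delta>])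
    fix t z :: "real ^ 'n" assume t: "t \<in> T" and z: "\<And>i. 0 \<le> z $ i \<and> z $ i < \<delta>"
    show "\<not> in_tile t (x + z)"
    proof
      assume it: "in_tile t (x + z)"
      have "- 1 \<le> t $ i - x $ i \<and> t $ i - x $ i \<le> 1" for i
      proof -
        have "t $ i \<le> x $ i + z $ i" "x $ i + z $ i < t $ i + 1"
          using it by (auto simp: in_tile_def)
        then show ?thesis using z[of i] \<delta>(3) by linarith
      qed
      with t have "t \<in> ?C" by blast
      with \<delta>(1) z it show False by blast
    qed
  qed (use \<delta> in auto)
qed

section \<open>Tiling by cubes and tiling by the kernel\<close>

lemma nn_integral_count_space_le:
  fixes f :: "'a \<Rightarrow> ennreal"
  assumes T: "countable T" and le: "\<And>F. finite F \<Longrightarrow> F \<subseteq> T \<Longrightarrow> (\<Sum>t\<in>F. f t) \<le> c"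
  shows "(\<integral>\<^sup>+t. f t \<partial>count_space T) \<le> c"
proof -
  \<comment> \<open>exhaust \<open>T\<close> by finite sets, along an enumeration\<close>
  define J where "J n = {t \<in> T. to_nat_on T t < n}" for n
  have fin: "finite (J n)" for n
    by (rule finite_imageD[of "to_nat_on T"])
       (auto simp: J_def intro: finite_subset[of _ "{..<n}"] inj_on_subset[OF inj_on_to_nat_on[OF T]])
  have "(\<integral>\<^sup>+t. f t \<partial>count_space T) = (\<integral>\<^sup>+t. (SUP n. f t * indicator (J n) t) \<partial>count_space T)"
  proof (intro nn_integral_cong antisym)
    fix t assume t: "t \<in> space (count_space T)"
    then show "f t \<le> (SUP n. f t * indicator (J n) t)"
      by (intro SUP_upper2[of "Suc (to_nat_on T t)"]) (auto simp: J_def)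
    show "(SUP n. f t * indicator (J n) t) \<le> f t"
      by (intro SUP_least) (auto split: split_indicator)
  qed
  also have "\<dots> = (SUP n. (\<integral>\<^sup>+t. f t * indicator (J n) t \<partial>count_space T))"
    by (rule nn_integral_monotone_convergence_SUP)
       (auto simp: incseq_def le_fun_def J_def split: split_indicator)
  also have "\<dots> \<le> c"
  proof (rule SUP_least)
    fix n
    have "(\<integral>\<^sup>+t. f t * indicator (J n) t \<partial>count_space T) = (\<Sum>t\<in>J n. f t * indicator (J n) t)"
      by (rule nn_integral_count_space'[OF fin]) (auto simp: J_def)
    also have "\<dots> = (\<Sum>t\<in>J n. f t)" by (intro sum.cong) auto
    also have "\<dots> \<le> c" by (rule le[OF fin]) (auto simp: J_def)
    finally show "(\<integral>\<^sup>+t. f t * indicator (J n) t \<partial>count_space T) \<le> c" .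
  qed
  finally show ?thesis .
qed

lemma sum_le_nn_integral_count_space:
  fixes f :: "'a \<Rightarrow> ennreal"
  assumes "finite F" "F \<subseteq> T"
  shows "(\<Sum>t\<in>F. f t) \<le> (\<integral>\<^sup>+t. f t \<partial>count_space T)"
proof -
  have "(\<Sum>t\<in>F. f t) = (\<Sum>t\<in>F. f t * indicator F t)" by (intro sum.cong) auto
  also have "\<dots> = (\<integral>\<^sup>+t. f t * indicator F t \<partial>count_space T)"
    by (rule nn_integral_count_space'[symmetric]) (use assms in auto)
  also have "\<dots> \<le> (\<integral>\<^sup>+t. f t \<partial>count_space T)"
    by (intro nn_integral_mono) (auto split: split_indicator)
  finally show ?thesis .
qed

text \<open>With values in the extended nonnegative reals, this and the next sum need no convergence
  condition and can be exchanged with integrals.\<close>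

definition cover_count :: "(real ^ 'n) set \<Rightarrow> real ^ 'n \<Rightarrow> ennreal" where
  "cover_count T x = (\<integral>\<^sup>+t. indicator unit_cube (x - t) \<partial>count_space T)"

definition kern_sum :: "(real ^ 'n) set \<Rightarrow> real ^ 'n \<Rightarrow> ennreal" where
  "kern_sum T x = (\<integral>\<^sup>+t. ennreal (kern (x - t)) \<partial>count_space T)"

lemma cover_count_eq_0:
  assumes "\<And>t. t \<in> T \<Longrightarrow> \<not> in_tile t x"
  shows "cover_count T x = 0"
  unfolding cover_count_def using assms
  by (subst nn_integral_0_iff_AE) (auto simp: AE_count_space in_tile_iff_diff)

lemma cover_count_eq_1:
  assumes "packing T" "t \<in> T" "in_tile t x"
  shows "cover_count T x = 1"
proof -
  have "indicator unit_cube (x - s) = (0 :: ennreal)" if "s \<in> T" "s \<notin> {t}" for s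
    using packingD[OF assms(1) that(1) assms(2) _ assms(3)] that by (auto simp: in_tile_iff_diff indicator_def)
  then have "cover_count T x = (\<Sum>s\<in>{t}. indicator unit_cube (x - s))"
    unfolding cover_count_def using assms(2) by (intro nn_integral_count_space') auto
  also have "\<dots> = 1" using assms(3) by (simp add: in_tile_iff_diff)
  finally show ?thesis .
qed

lemma cover_count_le_1: "packing T \<Longrightarrow> cover_count T x \<le> 1"
  using cover_count_eq_0[of T x] cover_count_eq_1[of T _ x] by (cases "\<exists>t\<in>T. in_tile t x") auto

lemma nn_integral_lborel_reflect:
  fixes f :: "'a::euclidean_space \<Rightarrow> ennreal"
  assumes [measurable]: "f \<in> borel_measurable borel"
  shows "(\<integral>\<^sup>+y. f y \<partial>lborel) = (\<integral>\<^sup>+y. f (a - y) \<partial>lborel)"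
  by (subst lborel_affine[of "-1" a]) (simp_all add: nn_integral_density nn_integral_distr)

text \<open>Both sides are the triple convolution, at \<open>x\<close>, of the cube, the kernel and the sum of
  unit masses at the points of \<open>T\<close>, bracketed in two ways. The left side averages the sum of
  translated kernels over a cube, the right side averages the number of covering cubes against
  the kernel.\<close>

lemma convolution_identity:
  fixes T :: "(real ^ 'n) set"
  assumes T: "countable T"
  shows "(\<integral>\<^sup>+y. indicator unit_cube y * kern_sum T (x - y) \<partial>lborel) =
    (\<integral>\<^sup>+y. cover_count T (x - y) * ennreal (kern y) \<partial>lborel)"
proof -
  have "(\<integral>\<^sup>+y. indicator unit_cube y * kern_sum T (x - y) \<partial>lborel) =
      (\<integral>\<^sup>+y. (\<integral>\<^sup>+t. indicator unit_cube y * ennreal (kern (x - y - t)) \<partial>count_space T) \<partial>lborel)"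
    unfolding kern_sum_def by (subst nn_integral_cmult) auto
  also have "\<dots> = (\<integral>\<^sup>+t. (\<integral>\<^sup>+y. indicator unit_cube y * ennreal (kern (x - y - t)) \<partial>lborel) \<partial>count_space T)"
    by (rule nn_integral_count_space_nn_integral[OF T]) measurable
  also have "\<dots> = (\<integral>\<^sup>+t. (\<integral>\<^sup>+y. indicator unit_cube (x - y - t) * ennreal (kern y) \<partial>lborel) \<partial>count_space T)"
  proof (rule nn_integral_cong)
    fix t
    show "(\<integral>\<^sup>+y. indicator unit_cube y * ennreal (kern (x - y - t)) \<partial>lborel) =
        (\<integral>\<^sup>+y. indicator unit_cube (x - y - t) * ennreal (kern y) \<partial>lborel)"
      by (subst nn_integral_lborel_reflect[of _ "x - t"]) (auto simp: algebra_simps)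
  qed
  also have "\<dots> = (\<integral>\<^sup>+y. (\<integral>\<^sup>+t. indicator unit_cube (x - y - t) * ennreal (kern y) \<partial>count_space T) \<partial>lborel)"
    by (rule nn_integral_count_space_nn_integral[OF T, symmetric]) measurable
  also have "\<dots> = (\<integral>\<^sup>+y. cover_count T (x - y) * ennreal (kern y) \<partial>lborel)"
    unfolding cover_count_def by (subst nn_integral_multc) auto
  finally show ?thesis .
qed

lemma borel_measurable_nn_integral_count_space:
  fixes f :: "'i \<Rightarrow> 'a \<Rightarrow> ennreal"
  assumes T: "countable T" and f: "\<And>t. t \<in> T \<Longrightarrow> f t \<in> borel_measurable M"
  shows "(\<lambda>x. \<integral>\<^sup>+t. f t x \<partial>count_space T) \<in> borel_measurable M"
proof -
  interpret sigma_finite_measure "count_space T"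
    by (rule sigma_finite_measure_count_space_countable[OF T])
  have "(\<lambda>p. f (fst p) (snd p)) \<in> borel_measurable (count_space T \<Otimes>\<^sub>M M)"
    by (rule measurable_pair_measure_countable1[OF T]) (simp add: f)
  from measurable_compose[OF measurable_pair_swap' this] show ?thesis
    by (intro borel_measurable_nn_integral) (simp add: split_beta')
qed

lemma borel_measurable_kern_sum:
  fixes T :: "(real ^ 'n) set"
  assumes "countable T"
  shows "kern_sum T \<in> borel_measurable borel"
  unfolding kern_sum_def[abs_def]
  by (rule borel_measurable_nn_integral_count_space[OF assms]) measurable

lemma borel_measurable_cover_count:
  fixes T :: "(real ^ 'n) set"
  assumes "countable T"
  shows "cover_count T \<in> borel_measurable borel"
  unfolding cover_count_def[abs_def]
  by (rule borel_measurable_nn_integral_count_space[OF assms]) measurable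

text \<open>The kernel has integral 1, so by the convolution identity the average of the covering number
  against the kernel is 1, the same as if every point were covered. An uncovered point would give
  a hole \<open>x - W\<close> with \<open>W\<close> a small open box next to 0, where the kernel is positive,
  and the average would be too small.\<close>

lemma kern_sum_full_imp_tiling:
  fixes T :: "(real ^ 'n) set"
  assumes T: "packing T" and full: "\<And>x. kern_sum T x = 1"
  shows "is_tiling_set unit_cube T"
proof -
  have "\<exists>t\<in>T. in_tile t x" for x
  proof (rule ccontr)
    assume "\<not> (\<exists>t\<in>T. in_tile t x)"
    then obtain \<delta> where \<delta>: "0 < \<delta>" "\<delta> \<le> 1"
      and unc: "\<And>t z. t \<in> T \<Longrightarrow> (\<And>i. 0 \<le> z $ i \<and> z $ i < \<delta>) \<Longrightarrow> \<not> in_tile t (x + z)"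
      using packing_uncovered_box[OF T, of x] by metis
    define W where "W = box (\<chi> i. - \<delta>) (0 :: real ^ 'n)"
    have W: "y \<in> W \<longleftrightarrow> (\<forall>i. - \<delta> < y $ i \<and> y $ i < 0)" for y
      by (simp add: W_def mem_box_cart)
    have [measurable]: "W \<in> sets borel" by (simp add: W_def)
    note [measurable] = borel_measurable_cover_count[OF packing_countable[OF T]]
    have cov0: "cover_count T (x - y) = 0" if "y \<in> W" for y
    proof (rule cover_count_eq_0)
      fix t assume "t \<in> T"
      from unc[OF this, of "- y"] that show "\<not> in_tile t (x - y)"
        unfolding W by (simp add: less_imp_le) (metis minus_less_iff)
    qed
    \<comment> \<open>the box and the covered part together cannot carry more than the total mass 1 of the kernel\<close>
    have "1 + (\<integral>\<^sup>+y. indicator W y * ennreal (kern y) \<partial>lborel) =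
        (\<integral>\<^sup>+y. indicator unit_cube y * kern_sum T (x - y) \<partial>lborel) +
        (\<integral>\<^sup>+y. indicator W y * ennreal (kern y) \<partial>lborel)"
      by (simp add: full emeasure_unit_cube)
    also have "\<dots> = (\<integral>\<^sup>+y. cover_count T (x - y) * ennreal (kern y) \<partial>lborel) +
        (\<integral>\<^sup>+y. indicator W y * ennreal (kern y) \<partial>lborel)"
      by (simp add: convolution_identity[OF packing_countable[OF T]])
    also have "\<dots> = (\<integral>\<^sup>+y. indicator W y * ennreal (kern y) + cover_count T (x - y) * ennreal (kern y) \<partial>lborel)"
      by (subst nn_integral_add) (auto simp: add.commute)
    also have "\<dots> \<le> (\<integral>\<^sup>+y. ennreal (kern (y :: real ^ 'n)) \<partial>lborel)"
    proof (rule nn_integral_mono)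
      fix y
      show "indicator W y * ennreal (kern y) + cover_count T (x - y) * ennreal (kern y) \<le> ennreal (kern y)"
        using cov0[of y] mult_right_mono[OF cover_count_le_1[OF T, of "x - y"], of "ennreal (kern y)"]
        by (cases "y \<in> W") auto
    qed
    also have "\<dots> = 1 + 0" by (simp add: nn_integral_kern)
    finally have "(\<integral>\<^sup>+y. indicator W y * ennreal (kern y) \<partial>lborel) = 0"
      by (subst (asm) ennreal_add_left_cancel_le) simp
    then have "AE y in lborel. indicator W y * ennreal (kern y) = 0"
      by (subst (asm) nn_integral_0_iff_AE) auto
    then have "AE y in lborel. y \<notin> W"
    proof eventually_elim
      case (elim y)
      show ?case
      proof
        assume y: "y \<in> W"
        \<comment> \<open>inside the box all coordinates lie strictly between -1 and 0, so the kernel does not vanish\<close>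
        with elim have "kern (y - 0) = 0" using kern_nonneg[of y] by simp
        then obtain i where "y $ i \<in> \<int>" "y $ i \<noteq> 0"
          unfolding kern_eq_0_iff by (auto simp: int_separated_def)
        then have "1 \<le> \<bar>y $ i\<bar>" by (intro Ints_nonzero_abs_ge1)
        moreover have "- \<delta> < y $ i" "y $ i < 0" using y by (auto simp: W)
        ultimately show False using \<delta> by linarith
      qed
    qed
    then have "W \<in> null_sets lborel"
      by (subst (asm) AE_iff_null_sets[symmetric]) auto
    then have "negligible W"
      by (simp add: negligible_iff_null_sets null_sets_completionI)
    moreover have "W \<noteq> {}"
    proof -
      have "(\<chi> i. - \<delta> / 2) \<in> W" using \<delta> by (simp add: W)
      then show ?thesis by blast
    qed
    ultimately show False
      using open_not_negligible[of W] by (simp add: W_def open_box)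
  qed
  then show ?thesis
    unfolding is_tiling_set_unit_cube_iff using packingD[OF T] by metis
qed

text \<open>Here the covering number is constantly 1, so by the convolution identity the sum of kernels,
  which is at most 1, has average 1 over every translate of the cube.\<close>

lemma tiling_imp_kern_sum_AE:
  fixes T :: "(real ^ 'n) set"
  assumes T: "is_tiling_set unit_cube T" and le: "\<And>x. kern_sum T x \<le> 1"
  shows "AE y in lborel. y \<in> unit_cube \<longrightarrow> kern_sum T (x - y) = 1"
proof -
  have pack: "packing T" by (rule tiling_imp_packing[OF T])
  note [measurable] = borel_measurable_kern_sum[OF packing_countable[OF pack]]
  have "cover_count T y = 1" for y
    using tiling_obtain[OF T] cover_count_eq_1[OF pack] by metis
  then have "(\<integral>\<^sup>+y. indicator unit_cube y * kern_sum T (x - y) \<partial>lborel) = 1"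
    by (simp add: convolution_identity[OF packing_countable[OF pack]] nn_integral_kern)
  then have "(\<integral>\<^sup>+y. indicator unit_cube y - indicator unit_cube y * kern_sum T (x - y) \<partial>lborel) = 0"
    using le by (subst nn_integral_diff) (auto simp: emeasure_unit_cube indicator_def)
  then have "AE y in lborel. indicator unit_cube y - indicator unit_cube y * kern_sum T (x - y) = 0"
    by (subst (asm) nn_integral_0_iff_AE) auto
  then show ?thesis
  proof eventually_elim
    case (elim y)
    show ?case
    proof
      assume "y \<in> unit_cube"
      with elim have "1 - kern_sum T (x - y) = 0" by simp
      then have "1 \<le> kern_sum T (x - y)" by (simp add: diff_eq_0_iff_ennreal)
      with le show "kern_sum T (x - y) = 1" by (simp add: antisym)
    qed
  qed
qed

section \<open>The space of square integrable functions on the cube\<close>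

definition msq :: "(real ^ 'n \<Rightarrow> complex) \<Rightarrow> real" where
  "msq f = (LINT x|lebesgue_on unit_cube. (cmod (f x))\<^sup>2)"

lemma msq_nonneg: "0 \<le> msq f"
  by (simp add: msq_def)

lemma L2_inner_self: "L2_inner unit_cube f f = of_real (msq f)"
  by (simp add: L2_inner_def msq_def complex_norm_square[symmetric] flip: of_real_power)

lemma L2_norm_eq: "L2_norm unit_cube f = sqrt (msq f)"
  by (simp add: L2_norm_def L2_inner_self)

lemma emeasure_lebesgue_unit_cube: "emeasure (lebesgue_on unit_cube) (unit_cube :: (real ^ 'n) set) = 1"
  by (subst emeasure_restrict_space) (auto simp: emeasure_unit_cube)

lemma space_lebesgue_unit_cube [simp]: "space (lebesgue_on unit_cube) = unit_cube"
  by (simp add: space_restrict_space)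

lemma finite_measure_unit_cube: "finite_measure (lebesgue_on (unit_cube :: (real ^ 'n) set))"
  by (rule finite_measureI) (simp add: emeasure_lebesgue_unit_cube)

lemma borel_measurable_unit_cube:
  "f \<in> borel_measurable borel \<Longrightarrow> f \<in> borel_measurable (lebesgue_on S)"
  by (intro measurable_restrict_space1 measurable_completion) simp

lemma integrable_bounded_unit_cube:
  fixes f :: "real ^ 'n \<Rightarrow> 'b :: {banach, second_countable_topology}"
  assumes "f \<in> borel_measurable (lebesgue_on unit_cube)" "\<And>x. x \<in> unit_cube \<Longrightarrow> norm (f x) \<le> B"
  shows "integrable (lebesgue_on unit_cube) f"
  by (rule finite_measure.integrable_const_bound[OF finite_measure_unit_cube, of _ B])
     (use assms in auto)

lemma bounded_in_L2:
  fixes f :: "real ^ 'n \<Rightarrow> complex"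
  assumes f: "f \<in> borel_measurable (lebesgue_on unit_cube)" "\<And>x. x \<in> unit_cube \<Longrightarrow> cmod (f x) \<le> B"
  shows "f \<in> L2 unit_cube"
proof -
  note [measurable] = f(1)
  have "integrable (lebesgue_on unit_cube) (\<lambda>x. (cmod (f x))\<^sup>2)"
    by (rule integrable_bounded_unit_cube[of _ "B\<^sup>2"]) (use f(2) in \<open>auto intro: power_mono\<close>)
  with f(1) show ?thesis by (simp add: L2_def)
qed

lemma msq_le:
  fixes f :: "real ^ 'n \<Rightarrow> complex"
  assumes f: "f \<in> borel_measurable (lebesgue_on unit_cube)" "\<And>x. x \<in> unit_cube \<Longrightarrow> cmod (f x) \<le> B"
  shows "msq f \<le> B\<^sup>2"
proof -
  note [measurable] = f(1)
  have "msq f \<le> (LINT x|lebesgue_on (unit_cube :: (real ^ 'n) set). B\<^sup>2)"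
    unfolding msq_def
    by (intro integral_mono integrable_bounded_unit_cube[of _ "B\<^sup>2"])
       (use f(2) in \<open>auto intro: power_mono\<close>)
  also have "\<dots> = B\<^sup>2"
    by (simp add: measure_def emeasure_lebesgue_unit_cube)
  finally show ?thesis .
qed

lemma cmod_add_square_le: "(cmod (a + b))\<^sup>2 \<le> 2 * (cmod a)\<^sup>2 + 2 * (cmod b)\<^sup>2"
proof -
  have "(cmod (a + b))\<^sup>2 \<le> (cmod a + cmod b)\<^sup>2"
    by (intro power_mono norm_triangle_ineq) auto
  also have "\<dots> \<le> 2 * (cmod a)\<^sup>2 + 2 * (cmod b)\<^sup>2"
    using sum_squares_bound[of "cmod a" "cmod b"] by (simp add: power2_sum)
  finally show ?thesis .
qed

lemma
  fixes f g :: "real ^ 'n \<Rightarrow> complex"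
  assumes f: "f \<in> L2 unit_cube" and g: "g \<in> L2 unit_cube"
  shows L2_add: "(\<lambda>x. f x + g x) \<in> L2 unit_cube"
    and msq_add_le: "msq (\<lambda>x. f x + g x) \<le> 2 * msq f + 2 * msq g"
proof -
  have [measurable]: "f \<in> borel_measurable (lebesgue_on unit_cube)" "g \<in> borel_measurable (lebesgue_on unit_cube)"
    and int: "integrable (lebesgue_on unit_cube) (\<lambda>x. (cmod (f x))\<^sup>2)"
      "integrable (lebesgue_on unit_cube) (\<lambda>x. (cmod (g x))\<^sup>2)"
    using f g by (auto simp: L2_def)
  have int2: "integrable (lebesgue_on unit_cube) (\<lambda>x. 2 * (cmod (f x))\<^sup>2 + 2 * (cmod (g x))\<^sup>2)"
    using int by simp
  have int3: "integrable (lebesgue_on unit_cube) (\<lambda>x. (cmod (f x + g x))\<^sup>2)"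
    by (rule Bochner_Integration.integrable_bound[OF int2])
       (auto intro!: AE_I2 order_trans[OF cmod_add_square_le])
  then show "(\<lambda>x. f x + g x) \<in> L2 unit_cube" by (simp add: L2_def)
  have "msq (\<lambda>x. f x + g x) \<le> (LINT x|lebesgue_on unit_cube. 2 * (cmod (f x))\<^sup>2 + 2 * (cmod (g x))\<^sup>2)"
    unfolding msq_def by (intro integral_mono int2 int3 cmod_add_square_le)
  also have "\<dots> = 2 * msq f + 2 * msq g"
    unfolding msq_def using int by simp
  finally show "msq (\<lambda>x. f x + g x) \<le> 2 * msq f + 2 * msq g" .
qed

lemma L2_scale:
  assumes "f \<in> L2 unit_cube" shows "(\<lambda>x. c * f x) \<in> L2 unit_cube"
  using assms by (auto simp: L2_def norm_mult power_mult_distrib)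

lemma msq_scale: "msq (\<lambda>x. c * f x) = (cmod c)\<^sup>2 * msq f"
  by (simp add: msq_def norm_mult power_mult_distrib)

lemma L2_diff:
  assumes "f \<in> L2 unit_cube" "g \<in> L2 unit_cube" shows "(\<lambda>x. f x - g x) \<in> L2 unit_cube"
  using L2_add[OF assms(1) L2_scale[OF assms(2), of "-1"]] by simp

lemma cmod_exponential [simp]: "cmod (exponential t x) = 1"
  unfolding exponential_def by (rule norm_exp_i_times)

lemma exponential_L2: "exponential t \<in> L2 (unit_cube :: (real ^ 'n) set)"
  by (rule bounded_in_L2[of _ 1]) (auto intro: borel_measurable_unit_cube)

lemma L2_exponential_sum:
  assumes "finite F"
  shows "(\<lambda>x. \<Sum>t\<in>F. c t * exponential t x) \<in> L2 (unit_cube :: (real ^ 'n) set)"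
  using assms
proof (induction F)
  case empty
  then show ?case by (simp add: L2_def)
next
  case (insert t F)
  then show ?case using L2_add[OF L2_scale[OF exponential_L2, of "c t" t] insert.IH] by simp
qed

lemma exponential_mult: "exponential s x * exponential t x = exponential (s + t) x"
  by (simp add: exponential_def mult_exp_exp algebra_simps inner_add_left)

lemma integrable_exponential: "integrable (lebesgue_on (unit_cube :: (real ^ 'n) set)) (exponential t)"
  by (rule integrable_bounded_unit_cube[of _ 1]) (auto intro: borel_measurable_unit_cube)

lemma exponential_0 [simp]: "exponential 0 x = 1"
  by (simp add: exponential_def)

lemma cnj_cube_char: "cnj (cube_char u) = cube_char (- u)"
proof -
  have "cnj (exponential u x) = exponential (- u) x" for x
    by (simp add: exponential_def exp_cnj)
  moreover have "cnj (cube_char u) = (LINT x|lebesgue_on unit_cube. cnj (exponential u x))"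
    unfolding cube_char_def by (rule Bochner_Integration.integral_cnj[symmetric])
  ultimately show ?thesis by (simp add: cube_char_def)
qed

text \<open>The Pythagorean identity in an orthonormal family. The coefficients of the orthogonal
  projection are \<open>cube_char (x - t)\<close>, with squared modulus \<open>kern (x - t)\<close>, so the kernel
  sum measures how much of \<open>exponential x\<close> lies in the span.\<close>

lemma msq_exponential_diff:
  fixes F :: "(real ^ 'n) set"
  assumes F: "finite F" and sep: "\<And>s t. s \<in> F \<Longrightarrow> t \<in> F \<Longrightarrow> s \<noteq> t \<Longrightarrow> int_separated s t"
  shows "msq (\<lambda>y. exponential x y - (\<Sum>t\<in>F. c t * exponential t y)) =
    1 - (\<Sum>t\<in>F. kern (x - t)) + (\<Sum>t\<in>F. (cmod (c t - cube_char (x - t)))\<^sup>2)"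
proof -
  define p where "p y = (\<Sum>t\<in>F. c t * exponential t y)" for y
  let ?k = "\<lambda>t. cube_char (x - t)"
  have k': "cube_char (t - x) = cnj (?k t)" for t by (simp add: cnj_cube_char)
  have expand: "(exponential x y - p y) * cnj (exponential x y - p y) =
      exponential 0 y - (\<Sum>t\<in>F. cnj (c t) * exponential (x - t) y)
        - (\<Sum>t\<in>F. c t * exponential (t - x) y)
        + (\<Sum>t\<in>F. \<Sum>s\<in>F. c t * cnj (c s) * exponential (t - s) y)" for y
  proof -
    have 1: "exponential x y * cnj (exponential x y) = exponential 0 y"
      by (simp add: exponential_mult_cnj)
    have 2: "exponential x y * cnj (p y) = (\<Sum>t\<in>F. cnj (c t) * exponential (x - t) y)"
      by (simp add: p_def sum_distrib_left exponential_mult_cnj[symmetric] mult_ac)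
    have 3: "p y * cnj (exponential x y) = (\<Sum>t\<in>F. c t * exponential (t - x) y)"
      by (simp add: p_def sum_distrib_right exponential_mult_cnj[symmetric] mult.assoc)
    have 4: "p y * cnj (p y) = (\<Sum>t\<in>F. \<Sum>s\<in>F. c t * cnj (c s) * exponential (t - s) y)"
      by (simp add: p_def sum_product exponential_mult_cnj[symmetric] mult_ac)
    show ?thesis
      unfolding 1[symmetric] 2[symmetric] 3[symmetric] 4[symmetric] by (simp add: algebra_simps)
  qed
  have "complex_of_real (msq (\<lambda>y. exponential x y - p y)) =
      (LINT y|lebesgue_on unit_cube. (exponential x y - p y) * cnj (exponential x y - p y))"
    by (simp add: L2_inner_self[symmetric] L2_inner_def)
  also have "\<dots> = cube_char (0 :: real ^ 'n) - (\<Sum>t\<in>F. cnj (c t) * ?k t) - (\<Sum>t\<in>F. c t * cnj (?k t))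
      + (\<Sum>t\<in>F. \<Sum>s\<in>F. c t * cnj (c s) * cube_char (t - s))"
    unfolding expand k'[symmetric] unfolding cube_char_def
    by (simp add: integrable_exponential del: exponential_0)
  also have "(\<Sum>t\<in>F. \<Sum>s\<in>F. c t * cnj (c s) * cube_char (t - s)) = (\<Sum>t\<in>F. c t * cnj (c t))"
  proof (rule sum.cong[OF refl])
    fix t assume t: "t \<in> F"
    have "(\<Sum>s\<in>F. c t * cnj (c s) * cube_char (t - s)) = (\<Sum>s\<in>{t}. c t * cnj (c s) * cube_char (t - s))"
      by (rule sum.mono_neutral_right) (use F t sep[OF t] cube_char_eq_0_iff in auto)
    then show "(\<Sum>s\<in>F. c t * cnj (c s) * cube_char (t - s)) = c t * cnj (c t)" by simp
  qed
  also have "cube_char (0 :: real ^ 'n) - (\<Sum>t\<in>F. cnj (c t) * ?k t) - (\<Sum>t\<in>F. c t * cnj (?k t)) + (\<Sum>t\<in>F. c t * cnj (c t))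
     = 1 - (\<Sum>t\<in>F. ?k t * cnj (?k t)) + (\<Sum>t\<in>F. (c t - ?k t) * cnj (c t - ?k t))"
    by (simp add: algebra_simps sum.distrib sum_subtractf)
  also have "\<dots> = complex_of_real (1 - (\<Sum>t\<in>F. kern (x - t)) + (\<Sum>t\<in>F. (cmod (c t - ?k t))\<^sup>2))"
    by (simp add: complex_norm_square[symmetric] cmod_cube_char[symmetric] del: complex_cnj_diff)
  finally show ?thesis unfolding p_def by (simp only: of_real_eq_iff)
qed

section \<open>Closed span of a set of exponentials\<close>

text \<open>Membership in the closed linear span of the exponentials with frequencies in \<open>T\<close>. The
  squared distance is used throughout, so that no square root intervenes.\<close>

definition approximable :: "(real ^ 'n) set \<Rightarrow> (real ^ 'n \<Rightarrow> complex) \<Rightarrow> bool" where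
  "approximable T f \<longleftrightarrow> f \<in> L2 unit_cube \<and>
    (\<forall>\<epsilon>>0. \<exists>F c. finite F \<and> F \<subseteq> T \<and> msq (\<lambda>x. f x - (\<Sum>t\<in>F. c t * exponential t x)) < \<epsilon>)"

lemma approximableD:
  assumes "approximable T f" "0 < \<epsilon>"
  obtains F c where "finite F" "F \<subseteq> T" "msq (\<lambda>x. f x - (\<Sum>t\<in>F. c t * exponential t x)) < \<epsilon>"
  using conjunct2[OF assms(1)[unfolded approximable_def], rule_format, OF assms(2)] that
  by (elim exE conjE)

lemma approximable_limit:
  assumes f: "f \<in> L2 unit_cube"
    and lim: "\<And>\<epsilon>. 0 < \<epsilon> \<Longrightarrow> \<exists>g. approximable T g \<and> msq (\<lambda>x. f x - g x) < \<epsilon>"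
  shows "approximable T f"
  unfolding approximable_def
proof (intro conjI f allI impI)
  fix \<epsilon> :: real assume "0 < \<epsilon>"
  then have e: "0 < \<epsilon> / 4" by simp
  obtain g where g: "approximable T g" "msq (\<lambda>x. f x - g x) < \<epsilon> / 4" using lim[OF e] by blast
  obtain F c where F: "finite F" "F \<subseteq> T" "msq (\<lambda>x. g x - (\<Sum>t\<in>F. c t * exponential t x)) < \<epsilon> / 4"
    by (rule approximableD[OF g(1) e])
  have gL: "g \<in> L2 unit_cube" using g(1) by (simp add: approximable_def)
  have "msq (\<lambda>x. f x - (\<Sum>t\<in>F. c t * exponential t x)) \<le>
      2 * msq (\<lambda>x. f x - g x) + 2 * msq (\<lambda>x. g x - (\<Sum>t\<in>F. c t * exponential t x))"
    using msq_add_le[OF L2_diff[OF f gL] L2_diff[OF gL L2_exponential_sum[OF F(1), of c]]] by simp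
  also have "\<dots> < \<epsilon>" using g(2) F(3) by simp
  finally show "\<exists>F c. finite F \<and> F \<subseteq> T \<and> msq (\<lambda>x. f x - (\<Sum>t\<in>F. c t * exponential t x)) < \<epsilon>"
    using F by blast
qed

text \<open>Two combinations over different finite sets of frequencies are merged by extending the
  coefficients by zero.\<close>

lemma approximable_add:
  assumes f: "approximable T f" and g: "approximable T g"
  shows "approximable T (\<lambda>x. f x + g x)"
proof -
  have L: "f \<in> L2 unit_cube" "g \<in> L2 unit_cube" using f g by (auto simp: approximable_def)
  show ?thesis
    unfolding approximable_def
  proof (intro conjI L2_add L allI impI)
    fix \<epsilon> :: real assume "0 < \<epsilon>"
    then have e: "0 < \<epsilon> / 4" by simp
    obtain F c where F: "finite F" "F \<subseteq> T" "msq (\<lambda>x. f x - (\<Sum>t\<in>F. c t * exponential t x)) < \<epsilon> / 4"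
      by (rule approximableD[OF f e])
    obtain G d where G: "finite G" "G \<subseteq> T" "msq (\<lambda>x. g x - (\<Sum>t\<in>G. d t * exponential t x)) < \<epsilon> / 4"
      by (rule approximableD[OF g e])
    define b where "b t = (if t \<in> F then c t else 0) + (if t \<in> G then d t else 0)" for t
    have "(\<Sum>t\<in>F \<union> G. b t * exponential t x) =
        (\<Sum>t\<in>F. c t * exponential t x) + (\<Sum>t\<in>G. d t * exponential t x)" for x
    proof -
      have "(\<Sum>t\<in>F \<union> G. (if t \<in> F then c t else 0) * exponential t x) = (\<Sum>t\<in>F. c t * exponential t x)"
        using F(1) G(1) by (intro sum.mono_neutral_cong_right) auto
      moreover have "(\<Sum>t\<in>F \<union> G. (if t \<in> G then d t else 0) * exponential t x) = (\<Sum>t\<in>G. d t * exponential t x)"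
        using F(1) G(1) by (intro sum.mono_neutral_cong_right) auto
      ultimately show ?thesis by (simp only: b_def distrib_right sum.distrib)
    qed
    then have "msq (\<lambda>x. f x + g x - (\<Sum>t\<in>F \<union> G. b t * exponential t x)) \<le>
        2 * msq (\<lambda>x. f x - (\<Sum>t\<in>F. c t * exponential t x)) + 2 * msq (\<lambda>x. g x - (\<Sum>t\<in>G. d t * exponential t x))"
      using msq_add_le[OF L2_diff[OF L(1) L2_exponential_sum[OF F(1), of c]]
          L2_diff[OF L(2) L2_exponential_sum[OF G(1), of d]]]
      by (simp add: algebra_simps)
    also have "\<dots> < \<epsilon>" using F(3) G(3) by simp
    finally show "\<exists>F c. finite F \<and> F \<subseteq> T \<and> msq (\<lambda>x. f x + g x - (\<Sum>t\<in>F. c t * exponential t x)) < \<epsilon>"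
      using F G by (intro exI[of _ "F \<union> G"] exI[of _ b]) auto
  qed
qed

lemma approximable_scale:
  assumes f: "approximable T f"
  shows "approximable T (\<lambda>x. a * f x)"
proof -
  have L: "f \<in> L2 unit_cube" using f by (auto simp: approximable_def)
  show ?thesis
    unfolding approximable_def
  proof (intro conjI L2_scale L allI impI)
    fix \<epsilon> :: real assume e: "0 < \<epsilon>"
    have pos: "0 < (cmod a)\<^sup>2 + 1" by (simp add: add_nonneg_pos)
    obtain F c where F: "finite F" "F \<subseteq> T"
      "msq (\<lambda>x. f x - (\<Sum>t\<in>F. c t * exponential t x)) < \<epsilon> / ((cmod a)\<^sup>2 + 1)"
      by (rule approximableD[OF f divide_pos_pos[OF e pos]])
    have "msq (\<lambda>x. a * f x - (\<Sum>t\<in>F. (a * c t) * exponential t x)) =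
        (cmod a)\<^sup>2 * msq (\<lambda>x. f x - (\<Sum>t\<in>F. c t * exponential t x))"
      by (simp add: msq_scale[symmetric] right_diff_distrib sum_distrib_left mult.assoc)
    also have "\<dots> \<le> ((cmod a)\<^sup>2 + 1) * msq (\<lambda>x. f x - (\<Sum>t\<in>F. c t * exponential t x))"
      by (intro mult_right_mono msq_nonneg) simp
    also have "\<dots> < \<epsilon>"
      using F(3) pos by (simp add: pos_less_divide_eq mult.commute)
    finally have "msq (\<lambda>x. a * f x - (\<Sum>t\<in>F. (a * c t) * exponential t x)) < \<epsilon>" .
    then show "\<exists>F c. finite F \<and> F \<subseteq> T \<and> msq (\<lambda>x. a * f x - (\<Sum>t\<in>F. c t * exponential t x)) < \<epsilon>"
      using F(1,2) by (intro exI conjI)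
  qed
qed

section \<open>Density of trigonometric polynomials\<close>

text \<open>An inductive presentation of the span of all exponentials makes closure under products an easy
  induction.\<close>

inductive_set trig_poly :: "(real ^ 'n \<Rightarrow> complex) set" where
  exponential: "exponential t \<in> trig_poly"
| add: "f \<in> trig_poly \<Longrightarrow> g \<in> trig_poly \<Longrightarrow> (\<lambda>x. f x + g x) \<in> trig_poly"
| scale: "f \<in> trig_poly \<Longrightarrow> (\<lambda>x. c * f x) \<in> trig_poly"

lemma trig_poly_continuous: "f \<in> trig_poly \<Longrightarrow> continuous_on S f"
  by (induction rule: trig_poly.induct) (auto intro!: continuous_intros continuous_exponential)

lemma trig_poly_const: "(\<lambda>_. c) \<in> trig_poly"
  using trig_poly.scale[OF trig_poly.exponential[of 0], of c] by simp

lemma trig_poly_mult: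
  assumes "f \<in> trig_poly" "g \<in> trig_poly"
  shows "(\<lambda>x. f x * g x) \<in> trig_poly"
proof -
  have E: "(\<lambda>x. exponential s x * g x) \<in> trig_poly" for s
    using assms(2)
  proof (induction rule: trig_poly.induct)
    case (exponential t)
    then show ?case by (simp add: exponential_mult trig_poly.exponential)
  next
    case (add f g)
    then show ?case by (simp add: distrib_left trig_poly.add)
  next
    case (scale f c)
    then show ?case using trig_poly.scale[OF scale.IH, of c] by (simp add: mult.left_commute)
  qed
  show ?thesis
    using assms(1)
  proof (induction rule: trig_poly.induct)
    case (exponential t)
    show ?case by (rule E)
  next
    case (add f g)
    then show ?case by (simp add: distrib_right trig_poly.add)
  next
    case (scale f c)
    then show ?case using trig_poly.scale[OF scale.IH, of c] by (simp add: mult.assoc)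
  qed
qed

lemma trig_poly_approximable:
  assumes "\<And>t. approximable T (exponential t)" "f \<in> trig_poly"
  shows "approximable T f"
  using assms(2)
proof (induction rule: trig_poly.induct)
  case (exponential t)
  show ?case by (rule assms(1))
next
  case (add f g)
  then show ?case by (intro approximable_add)
next
  case (scale f c)
  then show ?case by (intro approximable_scale)
qed

lemma exponential_eq_cos_sin:
  "exponential t x = of_real (cos (2 * pi * (t \<bullet> x))) + \<i> * of_real (sin (2 * pi * (t \<bullet> x)))"
  unfolding exponential_def by (simp add: complex_eq_iff Re_exp Im_exp)

lemma trig_poly_cos_sin:
  "(\<lambda>x. of_real (cos (2 * pi * (t \<bullet> x)))) \<in> trig_poly"
  "(\<lambda>x. of_real (sin (2 * pi * (t \<bullet> x)))) \<in> trig_poly"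
proof -
  have "(\<lambda>x. of_real (cos (2 * pi * (t \<bullet> x)))) = (\<lambda>x. (1/2) * exponential t x + (1/2) * exponential (- t) x)"
    by (simp add: exponential_eq_cos_sin fun_eq_iff complex_eq_iff)
  then show "(\<lambda>x. of_real (cos (2 * pi * (t \<bullet> x)))) \<in> trig_poly"
    by (simp only:) (intro trig_poly.intros)
  have "(\<lambda>x. of_real (sin (2 * pi * (t \<bullet> x)))) =
      (\<lambda>x. (- \<i> / 2) * exponential t x + (\<i> / 2) * exponential (- t) x)"
    by (simp add: exponential_eq_cos_sin fun_eq_iff complex_eq_iff)
  then show "(\<lambda>x. of_real (sin (2 * pi * (t \<bullet> x)))) \<in> trig_poly"
    by (simp only:) (intro trig_poly.intros)
qed

text \<open>The frequencies are arbitrary real vectors, so the real-valued trigonometric polynomials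
  separate all points, opposite faces of the cube included, and Stone-Weierstrass applies to
  every compact set.\<close>

lemma trig_poly_dense_real:
  fixes h :: "real ^ 'n \<Rightarrow> real"
  assumes K: "compact K" and h: "continuous_on K h" and e: "0 < e"
  obtains p where "p \<in> trig_poly" "\<And>x. x \<in> K \<Longrightarrow> cmod (of_real (h x) - p x) < e"
proof -
  let ?R = "{f :: real ^ 'n \<Rightarrow> real. (\<lambda>x. complex_of_real (f x)) \<in> trig_poly}"
  interpret function_ring_on ?R K
  proof
    show "compact K" by (rule K)
    show "continuous_on K f" if "f \<in> ?R" for f
    proof -
      have "continuous_on K (\<lambda>x. Re (complex_of_real (f x)))"
        using that by (intro continuous_intros trig_poly_continuous) simp
      then show ?thesis by simp
    qed
    show "(\<lambda>x. f x + g x) \<in> ?R" if "f \<in> ?R" "g \<in> ?R" for f g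
      using trig_poly.add[of "\<lambda>x. of_real (f x)" "\<lambda>x. of_real (g x)"] that by simp
    show "(\<lambda>x. f x * g x) \<in> ?R" if "f \<in> ?R" "g \<in> ?R" for f g
      using trig_poly_mult[of "\<lambda>x. of_real (f x)" "\<lambda>x. of_real (g x)"] that by simp
    show "(\<lambda>_. c) \<in> ?R" for c by (simp add: trig_poly_const)
    fix x y assume "x \<in> K" "y \<in> K" and ne: "x \<noteq> (y :: real ^ 'n)"
    \<comment> \<open>a frequency for which the phases at \<open>x\<close> and \<open>y\<close> differ by half a turn\<close>
    define t where "t = (1 / (2 * ((x - y) \<bullet> (x - y)))) *\<^sub>R (x - y)"
    have "t \<bullet> (x - y) = 1/2" using ne by (simp add: t_def)
    then have xy: "t \<bullet> x = t \<bullet> y + 1/2" by (simp add: inner_diff_right)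
    have "cos (2 * pi * (t \<bullet> x)) = - cos (2 * pi * (t \<bullet> y))"
      "sin (2 * pi * (t \<bullet> x)) = - sin (2 * pi * (t \<bullet> y))"
      unfolding xy by (simp_all add: distrib_left)
    moreover have "cos (2 * pi * (t \<bullet> y)) \<noteq> 0 \<or> sin (2 * pi * (t \<bullet> y)) \<noteq> 0"
      using sin_cos_squared_add[of "2 * pi * (t \<bullet> y)"] by (metis power_zero_numeral add_0 zero_neq_one)
    ultimately have "cos (2 * pi * (t \<bullet> x)) \<noteq> cos (2 * pi * (t \<bullet> y)) \<or>
        sin (2 * pi * (t \<bullet> x)) \<noteq> sin (2 * pi * (t \<bullet> y))"
      by auto
    then show "\<exists>f\<in>?R. f x \<noteq> f y"
    proof
      assume "cos (2 * pi * (t \<bullet> x)) \<noteq> cos (2 * pi * (t \<bullet> y))"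
      then show ?thesis by (intro bexI[of _ "\<lambda>x. cos (2 * pi * (t \<bullet> x))"]) (simp_all add: trig_poly_cos_sin)
    next
      assume "sin (2 * pi * (t \<bullet> x)) \<noteq> sin (2 * pi * (t \<bullet> y))"
      then show ?thesis by (intro bexI[of _ "\<lambda>x. sin (2 * pi * (t \<bullet> x))"]) (simp_all add: trig_poly_cos_sin)
    qed
  qed
  have "\<exists>g\<in>?R. \<forall>x\<in>K. \<bar>h x - g x\<bar> < e" by (rule Stone_Weierstrass_basic[OF h e])
  then obtain g where "g \<in> ?R" "\<forall>x\<in>K. \<bar>h x - g x\<bar> < e" by (rule bexE)
  then show ?thesis
    by (intro that[of "\<lambda>x. of_real (g x)"]) (auto simp flip: of_real_diff)
qed

lemma unit_cube_subset_cbox: "unit_cube \<subseteq> cbox (0 :: real ^ 'n) 1"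
  by (auto simp: unit_cube_def mem_box_cart less_imp_le)

lemma approximable_continuous:
  fixes g :: "real ^ 'n \<Rightarrow> complex"
  assumes T: "\<And>t. approximable T (exponential t)" and g: "continuous_on UNIV g"
  shows "approximable T g"
proof (rule approximable_limit)
  let ?K = "cbox (0 :: real ^ 'n) 1"
  have gm: "g \<in> borel_measurable borel" by (rule borel_measurable_continuous_onI[OF g])
  have gK: "continuous_on ?K g" using g continuous_on_subset by blast
  then have "bounded (g ` ?K)" by (intro compact_imp_bounded compact_continuous_image) auto
  then obtain B where B: "\<And>x. x \<in> ?K \<Longrightarrow> cmod (g x) \<le> B"
    by (auto simp: bounded_iff)
  show "g \<in> L2 unit_cube"
    by (rule bounded_in_L2[of _ B]) (use B unit_cube_subset_cbox gm in \<open>auto intro: borel_measurable_unit_cube\<close>)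
  fix \<epsilon> :: real assume "0 < \<epsilon>"
  \<comment> \<open>real and imaginary part contribute an error of \<open>e\<close> each\<close>
  define e where "e = sqrt \<epsilon> / 4"
  have e: "0 < e" using \<open>0 < \<epsilon>\<close> by (simp add: e_def)
  obtain p where p: "p \<in> trig_poly" "\<And>x. x \<in> ?K \<Longrightarrow> cmod (of_real (Re (g x)) - p x) < e"
    by (rule trig_poly_dense_real[of ?K "\<lambda>x. Re (g x)" e]) (use gK e in \<open>auto intro!: continuous_intros\<close>)
  obtain q where q: "q \<in> trig_poly" "\<And>x. x \<in> ?K \<Longrightarrow> cmod (of_real (Im (g x)) - q x) < e"
    by (rule trig_poly_dense_real[of ?K "\<lambda>x. Im (g x)" e]) (use gK e in \<open>auto intro!: continuous_intros\<close>)
  define r where "r x = p x + \<i> * q x" for x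
  have r: "r \<in> trig_poly" unfolding r_def[abs_def] by (intro trig_poly.add trig_poly.scale p q)
  have "cmod (g x - r x) \<le> 2 * e" if "x \<in> unit_cube" for x
  proof -
    have xK: "x \<in> ?K" using that unit_cube_subset_cbox by blast
    have "g x - r x = (of_real (Re (g x)) - p x) + \<i> * (of_real (Im (g x)) - q x)"
      by (subst (1) complex_eq[of "g x"]) (simp add: r_def algebra_simps)
    also have "cmod \<dots> \<le> cmod (of_real (Re (g x)) - p x) + cmod (\<i> * (of_real (Im (g x)) - q x))"
      by (rule norm_triangle_ineq)
    also have "\<dots> \<le> 2 * e" using p(2)[OF xK] q(2)[OF xK] by (simp add: norm_mult)
    finally show ?thesis .
  qed
  then have "msq (\<lambda>x. g x - r x) \<le> (2 * e)\<^sup>2"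
    using gm borel_measurable_continuous_onI[OF trig_poly_continuous[OF r]]
    by (intro msq_le borel_measurable_unit_cube) auto
  also have "\<dots> < \<epsilon>" using \<open>0 < \<epsilon>\<close> by (simp add: e_def power_divide)
  finally show "\<exists>g'. approximable T g' \<and> msq (\<lambda>x. g x - g' x) < \<epsilon>"
    using trig_poly_approximable[OF T r] by blast
qed

text \<open>Radial truncation to the disc of radius \<open>B\<close>. It is continuous, so it turns the continuous
  approximations of a bounded measurable function into uniformly bounded ones, as dominated
  convergence requires.\<close>

definition clip :: "real \<Rightarrow> complex \<Rightarrow> complex" where
  "clip B z = (B / max B (cmod z)) *\<^sub>R z"

lemma clip_eq: "0 < B \<Longrightarrow> cmod z \<le> B \<Longrightarrow> clip B z = z"
  by (simp add: clip_def max_def)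

lemma norm_clip_le: "0 < B \<Longrightarrow> cmod (clip B z) \<le> B"
  by (auto simp: clip_def max_def field_simps)

lemma norm_diff_clip_le: assumes "0 < B" shows "cmod (z - clip B z) \<le> cmod z"
proof -
  have "z - clip B z = (1 - B / max B (cmod z)) *\<^sub>R z" by (simp add: clip_def algebra_simps)
  moreover have "\<bar>1 - B / max B (cmod z)\<bar> \<le> 1"
  proof -
    have "0 \<le> B / max B (cmod z)" "B / max B (cmod z) \<le> 1"
      using assms by (auto simp: less_max_iff_disj divide_le_eq_1 intro!: divide_nonneg_nonneg)
    then show ?thesis by linarith
  qed
  ultimately show ?thesis using mult_right_mono[of _ 1 "cmod z"] by fastforce
qed

lemma isCont_clip: assumes "0 < B" shows "isCont (clip B) z"
proof -
  have "0 < max B (cmod z)" using assms by (simp add: less_max_iff_disj)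
  then show ?thesis unfolding clip_def by (intro continuous_intros) auto
qed

lemma approximable_L2_limit:
  fixes f :: "real ^ 'n \<Rightarrow> complex"
  assumes f: "f \<in> L2 unit_cube" and g: "\<And>n. approximable T (g n)"
    and lim: "AE x in lebesgue_on unit_cube. (\<lambda>n. g n x) \<longlonglongrightarrow> f x"
    and bound: "integrable (lebesgue_on unit_cube) w"
      "\<And>n x. x \<in> unit_cube \<Longrightarrow> (cmod (f x - g n x))\<^sup>2 \<le> w x"
  shows "approximable T f"
proof (rule approximable_limit[OF f])
  have [measurable]: "f \<in> borel_measurable (lebesgue_on unit_cube)"
    "\<And>n. g n \<in> borel_measurable (lebesgue_on unit_cube)"
    using f g by (auto simp: L2_def approximable_def)
  have "(\<lambda>n. LINT x|lebesgue_on unit_cube. (cmod (f x - g n x))\<^sup>2)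
      \<longlonglongrightarrow> (LINT x|lebesgue_on (unit_cube :: (real ^ 'n) set). 0)"
  proof (rule integral_dominated_convergence[OF _ _ bound(1)])
    show "AE x in lebesgue_on unit_cube. (\<lambda>n. (cmod (f x - g n x))\<^sup>2) \<longlonglongrightarrow> 0"
      using lim
    proof eventually_elim
      case (elim x)
      then have "(\<lambda>n. (cmod (f x - g n x))\<^sup>2) \<longlonglongrightarrow> (cmod (f x - f x))\<^sup>2" by (intro tendsto_intros)
      then show ?case by simp
    qed
    show "AE x in lebesgue_on unit_cube. norm ((cmod (f x - g n x))\<^sup>2) \<le> w x" for n
      using bound(2) by (intro AE_I2) auto
  qed measurable
  then have "(\<lambda>n. msq (\<lambda>x. f x - g n x)) \<longlonglongrightarrow> 0" by (simp add: msq_def)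
  then show "\<exists>h. approximable T h \<and> msq (\<lambda>x. f x - h x) < \<epsilon>" if "0 < \<epsilon>" for \<epsilon>
    using order_tendstoD(2)[of _ 0 sequentially \<epsilon>] that g eventually_happens' sequentially_bot by blast
qed

text \<open>A measurable function is the limit almost everywhere of continuous functions; after clipping,
  the convergence is dominated and hence holds in mean square.\<close>

lemma approximable_bounded:
  fixes f :: "real ^ 'n \<Rightarrow> complex"
  assumes T: "\<And>t. approximable T (exponential t)"
    and f: "f \<in> borel_measurable (lebesgue_on unit_cube)" and B: "0 < B" "\<And>x. x \<in> unit_cube \<Longrightarrow> cmod (f x) \<le> B"
  shows "approximable T f"
proof -
  have "f measurable_on unit_cube"
    using f by (simp add: measurable_on_iff_borel_measurable)
  then obtain N k where N: "negligible N" and k: "\<And>n. continuous_on UNIV (k n)"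
    and lim: "\<And>x. x \<notin> N \<Longrightarrow> (\<lambda>n. k n x) \<longlonglongrightarrow> (if x \<in> unit_cube then f x else 0)"
    unfolding measurable_on_def by blast
  show ?thesis
  proof (rule approximable_L2_limit)
    show "f \<in> L2 unit_cube" by (rule bounded_in_L2[OF f B(2)])
    show "approximable T (\<lambda>x. clip B (k n x))" for n
    proof (rule approximable_continuous[OF T])
      have "continuous_on UNIV (clip B \<circ> k n)"
        by (intro continuous_on_compose k continuous_at_imp_continuous_on) (simp add: isCont_clip[OF B(1)])
      then show "continuous_on UNIV (\<lambda>x. clip B (k n x))" by (simp add: o_def)
    qed
    have "AE x in lebesgue. x \<notin> N"
      using N by (simp add: negligible_iff_null_sets AE_not_in)
    then have "AE x in lebesgue. x \<in> unit_cube \<longrightarrow> (\<lambda>n. clip B (k n x)) \<longlonglongrightarrow> f x"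
    proof eventually_elim
      case (elim x)
      show ?case
      proof
        assume x: "x \<in> unit_cube"
        with lim[OF elim] have "(\<lambda>n. k n x) \<longlonglongrightarrow> f x" by simp
        from isCont_tendsto_compose[OF isCont_clip[OF B(1)] this]
        show "(\<lambda>n. clip B (k n x)) \<longlonglongrightarrow> f x" using clip_eq[OF B(1) B(2)[OF x]] by simp
      qed
    qed
    then show "AE x in lebesgue_on unit_cube. (\<lambda>n. clip B (k n x)) \<longlonglongrightarrow> f x"
      by (subst AE_restrict_space_iff) auto
    show "integrable (lebesgue_on unit_cube) (\<lambda>_. (B + B)\<^sup>2)"
      by (rule integrable_bounded_unit_cube) auto
    show "(cmod (f x - clip B (k n x)))\<^sup>2 \<le> (B + B)\<^sup>2" if "x \<in> unit_cube" for n x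
      by (intro power_mono order_trans[OF norm_triangle_ineq4] add_mono B(2) that norm_clip_le B(1)) auto
  qed
qed

lemma approximable_all:
  fixes f :: "real ^ 'n \<Rightarrow> complex"
  assumes T: "\<And>t. approximable T (exponential t)" and f: "f \<in> L2 unit_cube"
  shows "approximable T f"
proof (rule approximable_L2_limit[OF f])
  have fm: "f \<in> borel_measurable (lebesgue_on unit_cube)" using f by (simp add: L2_def)
  show "approximable T (\<lambda>x. clip (Suc n) (f x))" for n
  proof (rule approximable_bounded[OF T])
    have "clip (Suc n) \<in> borel_measurable borel"
      by (intro borel_measurable_continuous_onI continuous_at_imp_continuous_on ballI isCont_clip) simp
    then show "(\<lambda>x. clip (Suc n) (f x)) \<in> borel_measurable (lebesgue_on unit_cube)"
      by (rule measurable_compose[OF fm])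
    show "cmod (clip (Suc n) (f x)) \<le> Suc n" for x by (rule norm_clip_le) simp
  qed simp
  show "AE x in lebesgue_on unit_cube. (\<lambda>n. clip (Suc n) (f x)) \<longlonglongrightarrow> f x"
  proof (rule AE_I2, rule tendsto_eventually)
    fix x
    obtain m where m: "cmod (f x) \<le> real m" using real_arch_simple by blast
    show "\<forall>\<^sub>F n in sequentially. clip (Suc n) (f x) = f x"
      using eventually_ge_at_top[of m]
      by eventually_elim (use m in \<open>auto intro!: clip_eq\<close>)
  qed
  show "integrable (lebesgue_on unit_cube) (\<lambda>x. (cmod (f x))\<^sup>2)" using f by (simp add: L2_def)
  show "(cmod (f x - clip (Suc n) (f x)))\<^sup>2 \<le> (cmod (f x))\<^sup>2" for n x
    by (intro power_mono norm_diff_clip_le) auto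
qed

section \<open>Orthonormal bases of exponentials\<close>

text \<open>Bessel's inequality for \<open>exponential x\<close>.\<close>

lemma kern_sum_le_1:
  fixes T :: "(real ^ 'n) set"
  assumes sep: "\<And>s t. s \<in> T \<Longrightarrow> t \<in> T \<Longrightarrow> s \<noteq> t \<Longrightarrow> int_separated s t"
  shows "kern_sum T x \<le> 1"
  unfolding kern_sum_def
proof (rule nn_integral_count_space_le)
  show "countable T" by (intro packing_countable int_separated_imp_packing sep)
  fix F assume F: "finite F" "F \<subseteq> T"
  have "0 \<le> 1 - (\<Sum>t\<in>F. kern (x - t))"
    using msq_exponential_diff[OF F(1), of x "\<lambda>t. cube_char (x - t)"] F(2) sep
      msq_nonneg[of "\<lambda>y. exponential x y - (\<Sum>t\<in>F. cube_char (x - t) * exponential t y)"]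
    by (auto simp: subset_iff)
  then show "(\<Sum>t\<in>F. ennreal (kern (x - t))) \<le> 1"
    by (simp add: sum_ennreal kern_nonneg)
qed

text \<open>Equality in Bessel's inequality characterises the closed span.\<close>

lemma approximable_iff_kern_sum:
  fixes T :: "(real ^ 'n) set"
  assumes sep: "\<And>s t. s \<in> T \<Longrightarrow> t \<in> T \<Longrightarrow> s \<noteq> t \<Longrightarrow> int_separated s t"
  shows "approximable T (exponential x) \<longleftrightarrow> kern_sum T x = 1"
proof
  assume ap: "approximable T (exponential x)"
  have "1 \<le> kern_sum T x"
  proof (rule ennreal_le_epsilon)
    fix e :: real assume e: "0 < e"
    obtain F c where F: "finite F" "F \<subseteq> T" "msq (\<lambda>y. exponential x y - (\<Sum>t\<in>F. c t * exponential t y)) < e"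
      by (rule approximableD[OF ap e])
    have "msq (\<lambda>y. exponential x y - (\<Sum>t\<in>F. c t * exponential t y)) =
        1 - (\<Sum>t\<in>F. kern (x - t)) + (\<Sum>t\<in>F. (cmod (c t - cube_char (x - t)))\<^sup>2)"
      by (rule msq_exponential_diff[OF F(1)]) (use F(2) sep in blast)
    moreover have "0 \<le> (\<Sum>t\<in>F. (cmod (c t - cube_char (x - t)))\<^sup>2)" by (intro sum_nonneg) auto
    ultimately have "1 \<le> (\<Sum>t\<in>F. kern (x - t)) + e" using F(3) by linarith
    then have "1 \<le> ennreal ((\<Sum>t\<in>F. kern (x - t)) + e)" by (simp add: ennreal_ge_1)
    also have "\<dots> = (\<Sum>t\<in>F. ennreal (kern (x - t))) + ennreal e"
      using e by (simp add: sum_ennreal kern_nonneg ennreal_plus sum_nonneg)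
    also have "\<dots> \<le> kern_sum T x + ennreal e"
      unfolding kern_sum_def by (intro add_right_mono sum_le_nn_integral_count_space F)
    finally show "1 \<le> kern_sum T x + ennreal e" .
  qed
  with kern_sum_le_1[OF sep] show "kern_sum T x = 1" by (simp add: antisym)
next
  assume one: "kern_sum T x = 1"
  show "approximable T (exponential x)"
    unfolding approximable_def
  proof (intro conjI exponential_L2 allI impI, rule ccontr)
    fix \<epsilon> :: real assume e: "0 < \<epsilon>"
    assume no: "\<not> (\<exists>F c. finite F \<and> F \<subseteq> T \<and> msq (\<lambda>y. exponential x y - (\<Sum>t\<in>F. c t * exponential t y)) < \<epsilon>)"
    have "kern_sum T x \<le> ennreal (1 - \<epsilon>)"
      unfolding kern_sum_def
    proof (rule nn_integral_count_space_le)
      show "countable T" by (intro packing_countable int_separated_imp_packing sep)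
      fix F assume F: "finite F" "F \<subseteq> T"
      have "msq (\<lambda>y. exponential x y - (\<Sum>t\<in>F. cube_char (x - t) * exponential t y)) =
          1 - (\<Sum>t\<in>F. kern (x - t)) + (\<Sum>t\<in>F. (cmod (cube_char (x - t) - cube_char (x - t)))\<^sup>2)"
        by (rule msq_exponential_diff[OF F(1)]) (use F(2) sep in blast)
      moreover have "\<not> msq (\<lambda>y. exponential x y - (\<Sum>t\<in>F. cube_char (x - t) * exponential t y)) < \<epsilon>"
        by (rule notI, rule notE[OF no], intro exI conjI, rule F(1), rule F(2))
      ultimately have "(\<Sum>t\<in>F. kern (x - t)) \<le> 1 - \<epsilon>" by simp
      then show "(\<Sum>t\<in>F. ennreal (kern (x - t))) \<le> ennreal (1 - \<epsilon>)"
        by (simp add: sum_ennreal kern_nonneg ennreal_leI)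
    qed
    then have "1 \<le> ennreal (1 - \<epsilon>)" by (simp add: one)
    with e show False by (simp add: ennreal_ge_1)
  qed
qed

lemma approximable_exponential_limit:
  fixes T :: "(real ^ 'n) set"
  assumes "\<And>\<epsilon>. 0 < \<epsilon> \<Longrightarrow> \<exists>y. approximable T (exponential y) \<and> 1 - \<epsilon> < kern (x - y)"
  shows "approximable T (exponential x)"
proof (rule approximable_limit[OF exponential_L2])
  fix \<epsilon> :: real assume "0 < \<epsilon>"
  then obtain y where y: "approximable T (exponential y)" "1 - \<epsilon> < kern (x - y)" using assms by blast
  have "msq (\<lambda>u. exponential x u - cube_char (x - y) * exponential y u) = 1 - kern (x - y)"
    using msq_exponential_diff[of "{y}" x "\<lambda>t. cube_char (x - t)"] by simp
  with y(2) have "msq (\<lambda>u. exponential x u - cube_char (x - y) * exponential y u) < \<epsilon>" by simp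
  with approximable_scale[OF y(1)]
  show "\<exists>g. approximable T g \<and> msq (\<lambda>u. exponential x u - g u) < \<epsilon>" by blast
qed

text \<open>The frequencies for which the kernel sum is 1 have full measure and are therefore dense. The
  exponential depends continuously on its frequency in mean square, since the squared distance of
  \<open>exponential x\<close> from the line through \<open>exponential y\<close> is \<open>1 - kern (x - y)\<close>.\<close>

lemma tiling_imp_approximable_exponential:
  fixes T :: "(real ^ 'n) set"
  assumes T: "is_tiling_set unit_cube T"
  shows "approximable T (exponential x)"
proof (rule approximable_exponential_limit)
  fix \<epsilon> :: real assume "0 < \<epsilon>"
  have "\<forall>\<^sub>F u in nhds (0 :: real ^ 'n). 1 - \<epsilon> < kern u"
    using isCont_kern[of 0] \<open>0 < \<epsilon>\<close>
    by (intro order_tendstoD(1)[of kern 1]) (simp_all add: isCont_def tendsto_nhds_iff)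
  then obtain \<delta> where \<delta>: "0 < \<delta>" "\<And>u :: real ^ 'n. norm u < \<delta> \<Longrightarrow> 1 - \<epsilon> < kern u"
    unfolding eventually_nhds_metric by auto
  define W where "W = box (0 :: real ^ 'n) 1 \<inter> ball 0 \<delta>"
  \<comment> \<open>\<open>W\<close> is open and nonempty, so it is not contained in the exceptional null set\<close>
  have "\<exists>y\<in>W. kern_sum T (x - y) = 1"
  proof (rule ccontr)
    assume no: "\<not> (\<exists>y\<in>W. kern_sum T (x - y) = 1)"
    have WQ: "W \<subseteq> unit_cube" by (auto simp: W_def unit_cube_def mem_box_cart less_imp_le)
    have "AE y in lborel. y \<in> unit_cube \<longrightarrow> kern_sum T (x - y) = 1"
      by (intro tiling_imp_kern_sum_AE[OF T] kern_sum_le_1 Keller[OF T])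
    then have "AE y in lborel. y \<notin> W"
      by eventually_elim (use no WQ in blast)
    then have "W \<in> null_sets lborel"
      by (subst (asm) AE_iff_null_sets[symmetric]) (auto simp: W_def)
    then have "negligible W" by (simp add: negligible_iff_null_sets null_sets_completionI)
    moreover have "open W" by (auto simp: W_def open_box)
    moreover have "W \<noteq> {}"
    proof -
      obtain r where r: "0 < r" "r < 1" "r * norm (1 :: real ^ 'n) < \<delta>"
      proof (rule that)
        let ?r = "min (1/2) (\<delta> / (2 * norm (1 :: real ^ 'n)))"
        have n: "0 < norm (1 :: real ^ 'n)" by simp
        show "0 < ?r" using \<delta>(1) n by simp
        show "?r < 1" by simp
        have "?r * norm (1 :: real ^ 'n) \<le> \<delta> / (2 * norm (1 :: real ^ 'n)) * norm (1 :: real ^ 'n)"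
          by (intro mult_right_mono) auto
        also have "\<dots> < \<delta>" using \<delta>(1) n by simp
        finally show "?r * norm (1 :: real ^ 'n) < \<delta>" .
      qed
      then have "r *\<^sub>R 1 \<in> W" by (simp add: W_def mem_box_cart)
      then show ?thesis by blast
    qed
    ultimately show False using open_not_negligible by blast
  qed
  then obtain y where y: "y \<in> W" "kern_sum T (x - y) = 1" by blast
  have "approximable T (exponential (x - y))"
    using y(2) approximable_iff_kern_sum[of T] Keller[OF T] by blast
  moreover have "1 - \<epsilon> < kern (x - (x - y))" using \<delta>(2)[of y] y(1) by (simp add: W_def)
  ultimately show "\<exists>y. approximable T (exponential y) \<and> 1 - \<epsilon> < kern (x - y)" by blast
qed

lemma is_spectrum_unit_cube_iff:
  fixes T :: "(real ^ 'n) set"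
  shows "is_spectrum unit_cube T \<longleftrightarrow>
    (\<forall>s\<in>T. \<forall>t\<in>T. s \<noteq> t \<longrightarrow> int_separated s t) \<and> (\<forall>f\<in>L2 unit_cube. approximable T f)"
proof -
  have 1: "L2_inner unit_cube (exponential s) (exponential t) = (if s = t then 1 else 0) \<longleftrightarrow>
      (s \<noteq> t \<longrightarrow> int_separated s t)" for s t :: "real ^ 'n"
    by (cases "s = t") (simp_all add: L2_inner_exponential cube_char_eq_0_iff)
  have 2: "(\<forall>\<epsilon>>0. \<exists>F c. finite F \<and> F \<subseteq> T \<and> L2_norm unit_cube (\<lambda>x. f x - (\<Sum>t\<in>F. c t * exponential t x)) < \<epsilon>)
      \<longleftrightarrow> approximable T f" (is "?A \<longleftrightarrow> _") if f: "f \<in> L2 unit_cube" for f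
  proof
    assume A: ?A
    show "approximable T f"
      unfolding approximable_def
    proof (intro conjI f allI impI)
      fix \<epsilon> :: real assume "0 < \<epsilon>"
      then have "0 < sqrt \<epsilon>" by simp
      from A[rule_format, OF this]
      show "\<exists>F c. finite F \<and> F \<subseteq> T \<and> msq (\<lambda>x. f x - (\<Sum>t\<in>F. c t * exponential t x)) < \<epsilon>"
        unfolding L2_norm_eq real_sqrt_less_iff .
    qed
  next
    assume ap: "approximable T f"
    show ?A
    proof (intro allI impI)
      fix \<epsilon> :: real assume e: "0 < \<epsilon>"
      then have "0 < \<epsilon>\<^sup>2" by simp
      then obtain F c where F: "finite F" "F \<subseteq> T" "msq (\<lambda>x. f x - (\<Sum>t\<in>F. c t * exponential t x)) < \<epsilon>\<^sup>2"
        by (rule approximableD[OF ap])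
      have "L2_norm unit_cube (\<lambda>x. f x - (\<Sum>t\<in>F. c t * exponential t x)) < \<epsilon>"
        unfolding L2_norm_eq using F(3) e by (intro real_less_lsqrt) auto
      with F(1,2) show "\<exists>F c. finite F \<and> F \<subseteq> T \<and> L2_norm unit_cube (\<lambda>x. f x - (\<Sum>t\<in>F. c t * exponential t x)) < \<epsilon>"
        by (intro exI conjI)
    qed
  qed
  have 3: "(\<forall>f\<in>L2 unit_cube. \<forall>\<epsilon>>0. \<exists>F c. finite F \<and> F \<subseteq> T \<and>
      L2_norm unit_cube (\<lambda>x. f x - (\<Sum>t\<in>F. c t * exponential t x)) < \<epsilon>)
      \<longleftrightarrow> (\<forall>f\<in>L2 unit_cube. approximable T f)"
    by (rule ball_cong[OF refl 2])
  have "\<forall>t\<in>T. exponential t \<in> L2 unit_cube" by (simp add: exponential_L2)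
  then show ?thesis
    unfolding is_spectrum_def L2_orthonormal_basis_def 1 3 by simp
qed

theorem theorem1p1:
  fixes T :: "(real ^ 'n) set"
  shows "is_spectrum unit_cube T \<longleftrightarrow> is_tiling_set unit_cube T"
proof
  assume "is_spectrum unit_cube T"
  then have sep: "\<And>s t. s \<in> T \<Longrightarrow> t \<in> T \<Longrightarrow> s \<noteq> t \<Longrightarrow> int_separated s t"
    and ap: "\<And>f. f \<in> L2 unit_cube \<Longrightarrow> approximable T f"
    unfolding is_spectrum_unit_cube_iff by blast+
  have "kern_sum T x = 1" for x
    using ap[OF exponential_L2] approximable_iff_kern_sum[of T, OF sep] by blast
  with int_separated_imp_packing[of T, OF sep] show "is_tiling_set unit_cube T"
    by (rule kern_sum_full_imp_tiling)
next
  assume T: "is_tiling_set unit_cube T"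
  show "is_spectrum unit_cube T"
    unfolding is_spectrum_unit_cube_iff
    using Keller[OF T] approximable_all[OF tiling_imp_approximable_exponential[OF T]] by blast
qed

end
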